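(* Let $m,n\in\mathbb{N}$, let $Y\subset\mathbb{R}_c^m$ and $X\subset\mathbb{R}_c^n$, let $y\mapsto X(y)\subset X$ be a map assigning to each $y\in Y$ a subset of $X$, and let $F:X\times Y\to\mathbb{R}_c$ be continuous. Let $\mathrm{Opt}(y)=\{x\in X(y): F(x,y)=\max_{x'\in X(y)}F(x',y)\}$, and let $G:Y\to X$ be a function with $G(y)\in \mathrm{Opt}(y)$ for all $y\in Y$. Let $Y_1,Y_2\subset Y$, $y_1^*\in Y_1$, $y_2^*\in Y_2$, $y_*\in Y$, and let $\gamma:[-1,1]\to Y$ be a Borel-Turing computable, continuous path, such that: (i) $Y_1\cap Y_2=\varnothing$ and $G(Y_1)\cap G(Y_2)=\varnothing$; (ii) $\inf_{y_1\in Y_1,\,y_2\in Y_2}\|y_1-y_2\|=0$; (iii) $\inf_{y_1\in Y_1,\,y_2\in Y_2}\|G(y_1)-G(y_2)\|=\kappa>0$; (iv) $\gamma(-1)=y_1^*$, $\gamma(1)=y_2^*$, and $\gamma(t_0)=y_*$ for some $t_0\in(-1,1)$; (v) $\gamma([-1,t_0))\subset Y_1$ and $\gamma((t_0,1])\subset Y_2$; (vi) $G(Y_1)\subset G(Y_1)\cup G(Y_2)$ is decidable. Then $G$ is not Borel-Turing computable. Moreover, for every $\alpha<\frac{\kappa}{2}$ there does not exist a Borel-Turing computable function $G^*:Y\to X$ with $\|G-G^*\|_\infty\le\alpha$. If condition (vi) is replaced by the condition (vii) $Y_1\subset Y_1\cup Y_2$ is decidable, (with (i)--(v) retained), then $G$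 is not Banach-Mazur computable, and moreover for every $\alpha<\frac{\kappa}{2}$ there does not exist a Banach-Mazur computable function $G^*:Y\to X$ with $\|G-G^*\|_\infty\le\alpha$.
   Context: A function $\mathbb{N}\to\mathbb{N}$ is recursive if it is computed by a Turing machine (similarly for several natural-number arguments). A sequence of rationals $(r_k)$ is computable if there are recursive $s,p,q:\mathbb{N}\to\mathbb{N}$ (with $q$ nonvanishing) such that $r_k=(-1)^{s(k)}\frac{p(k)}{q(k)}$ for all $k$; analogously for double sequences. A real sequence $(x_n)$ converges effectively to $x$ if $|x_n-x|\le 2^{-n}$ for all $n$. A real number $x$ is computable if some computable rational sequence converges effectively to $x$; such a sequence is called a representation of $x$. $\mathbb{R}_c$ denotes the set of computable real numbers. A real sequence $(x_n)$ is computable if there is a computable rational double sequence $(q_{n,k})$ with $|q_{n,k}-x_n|\le 2^{-k}$ for all $n,k$. These notions extend componentwise to vectors. A function $f$ from a subset of $\mathbb{R}_c^N$ to $\mathbb{R}_c^M$ is Borel-Turing computable if there is a Turing machine that transforms every representation of every vector $x$ in the domain into a representation of $f(x)$. It is Banach-Mazur computable if for every computable sequence $(a_n)$ of vectors in the domain, the sequence $(f(a_n))$ is computable. For $A\subset B\subset\mathbb{R}_c^n$, "$A\subset B$ is decidable" means that there is a Turing machine which, given (any representation of) $x$, outputs $1$ if $x\in A$ and outputs $0$ if $x\in B\setminus A$; for $x\notin B$ its behaviour is arbitrary (it may output anything or fail to terminate). Intervals in the domain of $\gamma$ are understood to consist of computable reals (e.g. $[-1,1]$ means $[-1,1]\cap\mathbb{R}_c$).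 $\|\cdot\|$ denotes a fixed norm, and $\|G-G^*\|_\infty=\sup_{y\in Y}\|G(y)-G^*(y)\|$ with the same norm on the solution space as in (iii). *)

theory Defs
  imports "HOL-Analysis.Analysis"
begin

section \<open>Turing machines\<close>

text \<open>
  Deterministic machines with finitely many tapes, each infinite to the right; moving left
  on cell 0 leaves the head where it is. Symbols and states are natural numbers, 0 being the
  blank and the initial state. The finite transition table maps a state and the symbols under
  the heads to a new state and, for each tape, a symbol to write and a head move. A machine
  halts when no entry of its table applies. Since the table is finite, only finitely many
  states and symbols occur.
\<close>

datatype move = MoveLeft | Stay | MoveRight

record tm =
  ntapes :: nat
  table :: "nat \<times> nat list \<Rightarrow> (nat \<times> (nat \<times> move) list) option"

text \<open>Tapes 0, 1 and 2 carry the stream input, the word input and the output.\<close>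

definition is_tm :: "tm \<Rightarrow> bool" where
  "is_tm M \<longleftrightarrow> 3 \<le> ntapes M \<and> finite (dom (table M)) \<and>
     (\<forall>q syms q' acts. table M (q, syms) = Some (q', acts) \<longrightarrow>
        length syms = ntapes M \<and> length acts = ntapes M)"

type_synonym tape = "nat \<Rightarrow> nat"

record config =
  state :: nat
  heads :: "nat \<Rightarrow> nat"
  tapes :: "nat \<Rightarrow> tape"

fun move_head :: "move \<Rightarrow> nat \<Rightarrow> nat" where
  "move_head MoveLeft h = h - 1"
| "move_head Stay h = h"
| "move_head MoveRight h = h + 1"

definition scanned :: "tm \<Rightarrow> config \<Rightarrow> nat list" where
  "scanned M c = map (\<lambda>i. tapes c i (heads c i)) [0..<ntapes M]"

definition step :: "tm \<Rightarrow> config \<Rightarrow> config option" where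
  "step M c = (case table M (state c, scanned M c) of
     None \<Rightarrow> None
   | Some (q, acts) \<Rightarrow> Some
      \<lparr> state = q,
        heads = (\<lambda>i. if i < ntapes M then move_head (snd (acts ! i)) (heads c i) else heads c i),
        tapes = (\<lambda>i. if i < ntapes M then (tapes c i)(heads c i := fst (acts ! i))
                     else tapes c i) \<rparr>)"

definition halts_with :: "tm \<Rightarrow> config \<Rightarrow> config \<Rightarrow> bool" where
  "halts_with M c c' \<longleftrightarrow> (\<lambda>a b. step M a = Some b)\<^sup>*\<^sup>* c c' \<and> step M c' = None"

text \<open>Numbers are written in unary with symbol 1, each terminated by symbol 2.\<close>

definition encode :: "nat list \<Rightarrow> nat list" where
  "encode xs = concat (map (\<lambda>x. replicate x 1 @ [2]) xs)"

definition word_tape :: "nat list \<Rightarrow> tape" where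
  "word_tape w j = (if j < length w then w ! j else 0)"

text \<open>
  The infinite concatenation of the codes of \<open>u 0, u 1, \<dots>\<close>. It is used only for nonempty
  lists \<open>u k\<close>, so the first \<open>j + 1\<close> codes reach cell \<open>j\<close>.
\<close>

definition stream_tape :: "(nat \<Rightarrow> nat list) \<Rightarrow> tape" where
  "stream_tape u j = concat (map (\<lambda>k. encode (u k)) [0..<Suc j]) ! j"

definition blank_tape :: tape where
  "blank_tape = (\<lambda>_. 0)"

definition init_config :: "tape \<Rightarrow> nat list \<Rightarrow> config" where
  "init_config t args =
     \<lparr> state = 0, heads = (\<lambda>_. 0),
       tapes = (\<lambda>i. if i = 0 then t else if i = 1 then word_tape (encode args) else blank_tape) \<rparr>"

definition computes :: "tm \<Rightarrow> tape \<Rightarrow> nat list \<Rightarrow> nat list \<Rightarrow> bool" where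
  "computes M t args out \<longleftrightarrow>
     (\<exists>c. halts_with M (init_config t args) c \<and> tapes c 2 = word_tape (encode out))"


section \<open>Recursive functions and computable reals\<close>

definition recursive1 :: "(nat \<Rightarrow> nat) \<Rightarrow> bool" where
  "recursive1 f \<longleftrightarrow> (\<exists>M. is_tm M \<and> (\<forall>n. computes M blank_tape [n] [f n]))"

definition recursive2 :: "(nat \<Rightarrow> nat \<Rightarrow> nat) \<Rightarrow> bool" where
  "recursive2 f \<longleftrightarrow> (\<exists>M. is_tm M \<and> (\<forall>n k. computes M blank_tape [n, k] [f n k]))"

definition presents ::
  "(nat \<Rightarrow> nat) \<Rightarrow> (nat \<Rightarrow> nat) \<Rightarrow> (nat \<Rightarrow> nat) \<Rightarrow> (nat \<Rightarrow> rat) \<Rightarrow> bool" where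
  "presents s p q r \<longleftrightarrow> recursive1 s \<and> recursive1 p \<and> recursive1 q \<and>
     (\<forall>k. q k \<noteq> 0) \<and> (\<forall>k. r k = (-1) ^ s k * (of_nat (p k) / of_nat (q k)))"

definition computable_rat_seq :: "(nat \<Rightarrow> rat) \<Rightarrow> bool" where
  "computable_rat_seq r \<longleftrightarrow> (\<exists>s p q. presents s p q r)"

definition computable_rat_double_seq :: "(nat \<Rightarrow> nat \<Rightarrow> rat) \<Rightarrow> bool" where
  "computable_rat_double_seq r \<longleftrightarrow>
     (\<exists>s p q. recursive2 s \<and> recursive2 p \<and> recursive2 q \<and>
       (\<forall>n k. q n k \<noteq> 0) \<and>
       (\<forall>n k. r n k = (-1) ^ s n k * (of_nat (p n k) / of_nat (q n k))))"

definition converges_effectively :: "(nat \<Rightarrow> real) \<Rightarrow> real \<Rightarrow> bool" where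
  "converges_effectively x l \<longleftrightarrow> (\<forall>n. \<bar>x n - l\<bar> \<le> 1 / 2 ^ n)"

definition representation :: "(nat \<Rightarrow> rat) \<Rightarrow> real \<Rightarrow> bool" where
  "representation r x \<longleftrightarrow>
     computable_rat_seq r \<and> converges_effectively (\<lambda>k. of_rat (r k)) x"

definition Rc :: "real set" where
  "Rc = {x. \<exists>r. representation r x}"

definition Rc_vec :: "(real ^ 'n) set" where
  "Rc_vec = {x. \<forall>i. x $ i \<in> Rc}"

definition computable_real_seq :: "(nat \<Rightarrow> real) \<Rightarrow> bool" where
  "computable_real_seq x \<longleftrightarrow>
     (\<exists>q. computable_rat_double_seq q \<and> (\<forall>n k. \<bar>of_rat (q n k) - x n\<bar> \<le> 1 / 2 ^ k))"

definition computable_vec_seq :: "(nat \<Rightarrow> real ^ 'n) \<Rightarrow> bool" where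
  "computable_vec_seq a \<longleftrightarrow> (\<forall>i. computable_real_seq (\<lambda>n. a n $ i))"


section \<open>Computable functions on vectors of computable reals\<close>

text \<open>
  A representation of a vector is given by one representation per component, each
  of them presented by its sign, numerator and denominator functions.
\<close>

definition vec_representation ::
  "('n \<Rightarrow> nat \<Rightarrow> nat) \<Rightarrow> ('n \<Rightarrow> nat \<Rightarrow> nat) \<Rightarrow> ('n \<Rightarrow> nat \<Rightarrow> nat) \<Rightarrow> real ^ 'n \<Rightarrow> bool" where
  "vec_representation s p q x \<longleftrightarrow>
     (\<forall>i. \<exists>r. presents (s i) (p i) (q i) r \<and> representation r (x $ i))"

text \<open>
  The \<open>k\<close>-th rational vector as a list of numbers. The components are listed in the order
  of the fixed bijection \<open>from_nat_into UNIV\<close> between \<open>{..<CARD('n)}\<close> and the index type.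
\<close>

definition row ::
  "('n::finite \<Rightarrow> nat \<Rightarrow> nat) \<Rightarrow> ('n \<Rightarrow> nat \<Rightarrow> nat) \<Rightarrow> ('n \<Rightarrow> nat \<Rightarrow> nat) \<Rightarrow> nat \<Rightarrow> nat list" where
  "row s p q k =
     concat (map (\<lambda>l. let i = from_nat_into UNIV l in [s i k, p i k, q i k]) [0..<CARD('n)])"

text \<open>
  The machine has the whole representation of \<open>x\<close> on its stream tape, and on argument \<open>k\<close> it
  outputs the \<open>k\<close>-th member of a representation of \<open>f x\<close>.
\<close>

definition borel_turing_computable_on :: "(real ^ 'n) set \<Rightarrow> (real ^ 'n \<Rightarrow> real ^ 'm) \<Rightarrow> bool" where
  "borel_turing_computable_on D f \<longleftrightarrow>
     (\<exists>M. is_tm M \<and>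
       (\<forall>x\<in>D. \<forall>s p q. vec_representation s p q x \<longrightarrow>
          (\<exists>s' p' q'. vec_representation s' p' q' (f x) \<and>
             (\<forall>k. computes M (stream_tape (row s p q)) [k] (row s' p' q' k)))))"

definition banach_mazur_computable_on :: "(real ^ 'n) set \<Rightarrow> (real ^ 'n \<Rightarrow> real ^ 'm) \<Rightarrow> bool" where
  "banach_mazur_computable_on D f \<longleftrightarrow>
     (\<forall>a. (\<forall>n. a n \<in> D) \<and> computable_vec_seq a \<longrightarrow> computable_vec_seq (\<lambda>n. f (a n)))"

definition decidable_within :: "(real ^ 'n) set \<Rightarrow> (real ^ 'n) set \<Rightarrow> bool" where
  "decidable_within A B \<longleftrightarrow>
     (\<exists>M. is_tm M \<and>
       (\<forall>x\<in>B. \<forall>s p q. vec_representation s p q x \<longrightarrow>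
          computes M (stream_tape (row s p q)) [] [if x \<in> A then 1 else 0]))"


section \<open>Norms and optimal solutions\<close>

definition is_norm :: "(real ^ 'n \<Rightarrow> real) \<Rightarrow> bool" where
  "is_norm N \<longleftrightarrow> (\<forall>x. 0 \<le> N x) \<and> (\<forall>x. N x = 0 \<longleftrightarrow> x = 0) \<and>
     (\<forall>c x. N (c *\<^sub>R x) = \<bar>c\<bar> * N x) \<and> (\<forall>x y. N (x + y) \<le> N x + N y)"

text \<open>Extended reals, because the supremum may be infinite.\<close>

definition sup_dist ::
  "(real ^ 'n \<Rightarrow> real) \<Rightarrow> 'a set \<Rightarrow> ('a \<Rightarrow> real ^ 'n) \<Rightarrow> ('a \<Rightarrow> real ^ 'n) \<Rightarrow> ereal" where
  "sup_dist N Y f g = (SUP y\<in>Y. ereal (N (f y - g y)))"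

definition Opt :: "('x \<Rightarrow> 'y \<Rightarrow> real) \<Rightarrow> ('y \<Rightarrow> 'x set) \<Rightarrow> 'y \<Rightarrow> 'x set" where
  "Opt F Xc y = {x \<in> Xc y. \<forall>x'\<in>Xc y. F x' y \<le> F x y}"

end

theory Submission
  imports Defs "HOL-Library.Nat_Bijection"
begin

text \<open>
  Along \<open>\<gamma>\<close> the values of \<open>G\<close>, and of any \<open>H\<close> that approximates it well enough, jump at \<open>t0\<close>,
  and on one side of \<open>t0\<close> they stay away from the value at \<open>t0\<close>. Let \<open>t n\<close> be \<open>t0\<close> unless
  machine \<open>n\<close> answers 0 on input \<open>n\<close>; if it does so after \<open>m\<close> steps, let \<open>t n\<close> be a rational
  number on that side at distance at most \<open>2\<^sup>-\<^sup>m\<close>. This sequence is computable, so if \<open>H\<close> were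
  Banach--Mazur computable, then approximations of \<open>H (\<gamma> (t n))\<close> would decide this form of the
  halting problem. A Borel--Turing computable function is Banach--Mazur computable, because a
  machine can be simulated on a computed stream tape; this covers \<open>\<gamma>\<close> and the Borel--Turing half.
\<close>

section \<open>Counter programs\<close>

text \<open>All computability notions are stated through Turing machines, so two bridges are needed:
  a machine must be built to show a function recursive, and a given machine must be run inside
  another computation to use one. The notion \<open>comput\<close> sits in between: compilation
  leads from it to machines, simulation leads back, and its closure properties do the rest.

  The choice of the side of \<open>t0\<close> is classical, and so are the machine codes and
  rational thresholds used: only the existence of one computable sequence is at stake. The bound on
  \<alpha> comes from the triangle inequality: across \<open>t0\<close> the values of
  \<open>H\<close> are at least \<open>\<kappa> - 2 * \<alpha>\<close> apart, so on at least one
  side they all keep half of this distance from the value at \<open>t0\<close>. Beyond that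
  distance, equality with the value at \<open>t0\<close> is settled by one approximation of fixed
  precision, and this is what decides an undecidable problem.\<close>

datatype prog = Skip | Inc nat | Dec nat | Seq prog prog (infixr ";;" 60) | While nat prog

type_synonym store = "nat \<Rightarrow> nat"

inductive exec :: "prog \<Rightarrow> store \<Rightarrow> store \<Rightarrow> bool" where
  Skip: "exec Skip s s"
| Inc: "exec (Inc r) s (s(r := Suc (s r)))"
| Dec: "exec (Dec r) s (s(r := s r - 1))"
| Seq: "exec P s s' \<Longrightarrow> exec Q s' s'' \<Longrightarrow> exec (P ;; Q) s s''"
| While_zero: "s r = 0 \<Longrightarrow> exec (While r P) s s"
| While_step: "s r \<noteq> 0 \<Longrightarrow> exec P s s' \<Longrightarrow> exec (While r P) s' s'' \<Longrightarrow> exec (While r P) s s''"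

lemma exec_Inc: "s' = s(r := Suc (s r)) \<Longrightarrow> exec (Inc r) s s'"
  by (simp add: exec.Inc)

lemma exec_Dec: "s' = s(r := s r - 1) \<Longrightarrow> exec (Dec r) s s'"
  using exec.Dec[of r s] by simp

lemma exec_While_zero: "s r = 0 \<Longrightarrow> s' = s \<Longrightarrow> exec (While r P) s s'"
  by (simp add: exec.While_zero)

definition clear_reg :: "nat \<Rightarrow> prog" where
  "clear_reg r = While r (Dec r)"

lemma exec_clear: "s' = s(r := 0) \<Longrightarrow> exec (clear_reg r) s s'"
proof -
  have "exec (clear_reg r) s (s(r := 0))"
  proof (induction "s r" arbitrary: s)
    case 0
    then show ?case unfolding clear_reg_def by (intro exec_While_zero) auto
  next
    case (Suc n)
    have "exec (clear_reg r) (s(r := n)) (s(r := n, r := 0))" by (rule Suc.hyps(1)) simp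
    then show ?case unfolding clear_reg_def
      using Suc.hyps(2)[symmetric] exec.Dec[of r s] by (intro exec.While_step[of s r]) auto
  qed
  then show "s' = s(r := 0) \<Longrightarrow> exec (clear_reg r) s s'" by simp
qed

definition move_reg :: "nat \<Rightarrow> nat \<Rightarrow> prog" where
  "move_reg r t = While r (Dec r ;; Inc t)"

lemma exec_move:
  assumes "r \<noteq> t" "s' = s(r := 0, t := s t + s r)"
  shows "exec (move_reg r t) s s'"
proof -
  have "exec (move_reg r t) s (s(r := 0, t := s t + s r))"
  proof (induction "s r" arbitrary: s)
    case 0
    then show ?case unfolding move_reg_def by (intro exec_While_zero) auto
  next
    case (Suc n)
    let ?s = "s(r := n, t := Suc (s t))"
    have "exec (move_reg r t) ?s (?s(r := 0, t := ?s t + ?s r))"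
      by (rule Suc.hyps(1)) (use assms in simp)
    moreover have "?s(r := 0, t := ?s t + ?s r) = s(r := 0, t := s t + s r)"
      using assms(1) Suc.hyps(2)[symmetric] by auto
    moreover have "exec (Dec r ;; Inc t) s ?s"
      using assms(1) Suc.hyps(2)[symmetric]
      by (intro exec.Seq[OF exec.Dec] exec_Inc) auto
    ultimately show ?case unfolding move_reg_def
      using Suc.hyps(2)[symmetric] by (metis exec.While_step nat.distinct(1))
  qed
  then show ?thesis using assms by simp
qed

text \<open>A counter can be read only by counting it down, so copying goes through a scratch
  register \<open>u\<close>, from which the source is restored afterwards.\<close>

definition copy_reg :: "nat \<Rightarrow> nat \<Rightarrow> nat \<Rightarrow> prog" where
  "copy_reg r t u = While r (Dec r ;; Inc t ;; Inc u) ;; move_reg u r"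

lemma exec_copy:
  assumes "r \<noteq> t" "r \<noteq> u" "t \<noteq> u" "s u = 0" "s' = s(t := s t + s r)"
  shows "exec (copy_reg r t u) s s'"
proof -
  have "exec (While r (Dec r ;; Inc t ;; Inc u)) s (s(r := 0, t := s t + s r, u := s u + s r))" for s
  proof (induction "s r" arbitrary: s)
    case 0
    then show ?case by (intro exec_While_zero) auto
  next
    case (Suc n)
    let ?s = "s(r := n, t := Suc (s t), u := Suc (s u))"
    have "exec (While r (Dec r ;; Inc t ;; Inc u)) ?s
            (?s(r := 0, t := ?s t + ?s r, u := ?s u + ?s r))"
      by (rule Suc.hyps(1)) (use assms in simp)
    moreover have "?s(r := 0, t := ?s t + ?s r, u := ?s u + ?s r)
        = s(r := 0, t := s t + s r, u := s u + s r)"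
      using assms(1-3) Suc.hyps(2)[symmetric] by auto
    moreover have "exec (Dec r ;; Inc t ;; Inc u) s ?s"
      using assms(1-3) Suc.hyps(2)[symmetric]
      by (intro exec.Seq[OF exec.Dec] exec.Seq[OF exec.Inc] exec_Inc) auto
    ultimately show ?case
      using Suc.hyps(2)[symmetric] by (metis exec.While_step nat.distinct(1))
  qed
  then show ?thesis unfolding copy_reg_def
  proof (rule exec.Seq)
    show "exec (move_reg u r) (s(r := 0, t := s t + s r, u := s u + s r)) s'"
      unfolding assms(5) by (rule exec_move) (use assms(1-4) in auto)
  qed
qed

section \<open>Functions of argument lists computed by counter programs\<close>

definition arg :: "nat \<Rightarrow> nat list \<Rightarrow> nat" where
  "arg i e = (if i < length e then e ! i else 0)"

lemma arg_simps [simp]: "arg 0 (x # e) = x" "arg (Suc i) (x # e) = arg i e" "arg i [] = 0"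
  by (simp_all add: arg_def)

lemma arg_tl: "arg i (tl e) = arg (Suc i) e"
  by (cases e) (simp_all)

text \<open>
  A program for \<open>f\<close> is uniform in the places of its arguments: it finds them in the registers
  \<open>rs\<close>, uses the registers from \<open>d\<close> on as a stack that is empty on entry, and leaves only the
  value on top. Calls of such programs nest without interference.
\<close>

definition comput :: "(nat list \<Rightarrow> nat) \<Rightarrow> bool" where
  "comput f \<longleftrightarrow> (\<exists>P. \<forall>rs d s. (\<forall>r\<in>set rs. r < d) \<longrightarrow> (\<forall>i\<ge>d. s i = 0) \<longrightarrow>
     exec (P rs d) s (s(d := f (map s rs))))"

lemma comput_obtain:
  assumes "comput f"
  obtains P where "\<And>rs d s s'. (\<And>r. r \<in> set rs \<Longrightarrow> r < d) \<Longrightarrow> (\<And>i. i \<ge> d \<Longrightarrow> s i = 0) \<Longrightarrow>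
     s' = s(d := f (map s rs)) \<Longrightarrow> exec (P rs d) s s'"
proof -
  from assms obtain P where
    "\<forall>rs d s. (\<forall>r\<in>set rs. r < d) \<longrightarrow> (\<forall>i\<ge>d. s i = 0) \<longrightarrow>
       exec (P rs d) s (s(d := f (map s rs)))"
    unfolding comput_def by (elim exE)
  then show thesis by (intro that[of P]) simp
qed

lemma computI:
  assumes "\<And>rs d s. (\<And>r. r \<in> set rs \<Longrightarrow> r < d) \<Longrightarrow> (\<And>i. i \<ge> d \<Longrightarrow> s i = 0) \<Longrightarrow>
     exec (P rs d) s (s(d := f (map s rs)))"
  shows "comput f"
  unfolding comput_def using assms by blast

text \<open>The empty program is correct because the result register \<open>d\<close> is already 0
  on entry.\<close>

lemma comput_zero: "comput (\<lambda>e. 0)"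
  by (rule computI[of "\<lambda>rs d. Skip"]) (metis exec.Skip fun_upd_triv order_refl)

lemma comput_arg: "comput (arg i)"
proof (rule computI[of "\<lambda>rs d. if i < length rs then copy_reg (rs ! i) d (Suc d) else Skip"])
  fix rs :: "nat list" and d and s :: store
  assume rs: "\<And>r. r \<in> set rs \<Longrightarrow> r < d" and z: "\<And>i. i \<ge> d \<Longrightarrow> s i = 0"
  show "exec (if i < length rs then copy_reg (rs ! i) d (Suc d) else Skip) s
          (s(d := arg i (map s rs)))"
  proof (cases "i < length rs")
    case True
    then have "rs ! i < d" using rs by simp
    with True z show ?thesis
      by (auto simp: arg_def intro!: exec_copy)
  next
    case False
    then have "s(d := arg i (map s rs)) = s" using z by (auto simp: arg_def)
    with False show ?thesis by (simp add: exec.Skip)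
  qed
qed

lemma comput_Suc: assumes "comput f" shows "comput (\<lambda>e. Suc (f e))"
proof -
  from comput_obtain[OF assms] obtain P where P:
    "\<And>rs d s s'. (\<And>r. r \<in> set rs \<Longrightarrow> r < d) \<Longrightarrow> (\<And>i. i \<ge> d \<Longrightarrow> s i = 0) \<Longrightarrow>
     s' = s(d := f (map s rs)) \<Longrightarrow> exec (P rs d) s s'" by blast
  show ?thesis
    by (rule computI[of "\<lambda>rs d. P rs d ;; Inc d"]) (rule exec.Seq[OF P[OF _ _ refl]], auto intro!: exec_Inc)
qed

lemma comput_tl: assumes "comput f" shows "comput (\<lambda>e. f (tl e))"
proof -
  from comput_obtain[OF assms] obtain P where P:
    "\<And>rs d s s'. (\<And>r. r \<in> set rs \<Longrightarrow> r < d) \<Longrightarrow> (\<And>i. i \<ge> d \<Longrightarrow> s i = 0) \<Longrightarrow>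
     s' = s(d := f (map s rs)) \<Longrightarrow> exec (P rs d) s s'" by blast
  show ?thesis
  proof (rule computI[of "\<lambda>rs d. P (tl rs) d"])
    fix rs :: "nat list" and d and s :: store
    assume rs: "\<And>r. r \<in> set rs \<Longrightarrow> r < d" and z: "\<And>i. i \<ge> d \<Longrightarrow> s i = 0"
    have "set (tl rs) \<subseteq> set rs" by (cases rs) auto
    then show "exec (P (tl rs) d) s (s(d := f (tl (map s rs))))"
      using rs z by (intro P) (auto simp: map_tl)
  qed
qed

text \<open>Composition in de Bruijn style: the value of \<open>g\<close> stays on the stack while
  \<open>f\<close> runs and is visible to it as argument 0. Then it is erased and the result of
  \<open>f\<close> is moved down into its place.\<close>

lemma comput_let:
  assumes "comput g" "comput f"
  shows "comput (\<lambda>e. f (g e # e))"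
proof -
  from comput_obtain[OF assms(1)] obtain P where P:
    "\<And>rs d s s'. (\<And>r. r \<in> set rs \<Longrightarrow> r < d) \<Longrightarrow> (\<And>i. i \<ge> d \<Longrightarrow> s i = 0) \<Longrightarrow>
     s' = s(d := g (map s rs)) \<Longrightarrow> exec (P rs d) s s'" by blast
  from comput_obtain[OF assms(2)] obtain Q where Q:
    "\<And>rs d s s'. (\<And>r. r \<in> set rs \<Longrightarrow> r < d) \<Longrightarrow> (\<And>i. i \<ge> d \<Longrightarrow> s i = 0) \<Longrightarrow>
     s' = s(d := f (map s rs)) \<Longrightarrow> exec (Q rs d) s s'" by blast
  show ?thesis
  proof (rule computI[of "\<lambda>rs d. P rs d ;; Q (d # rs) (Suc d) ;; clear_reg d ;; move_reg (Suc d) d"])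
    fix rs :: "nat list" and d and s :: store
    assume rs: "\<And>r. r \<in> set rs \<Longrightarrow> r < d" and z: "\<And>i. i \<ge> d \<Longrightarrow> s i = 0"
    let ?x = "g (map s rs)"
    let ?y = "f (?x # map s rs)"
    have 1: "exec (P rs d) s (s(d := ?x))"
      by (rule P) (use rs z in auto)
    have 2: "exec (Q (d # rs) (Suc d)) (s(d := ?x)) (s(d := ?x, Suc d := ?y))"
    proof (rule Q)
      have "map (s(d := ?x)) rs = map s rs" using rs by (intro map_cong) force+
      then show "s(d := ?x, Suc d := ?y) = (s(d := ?x))(Suc d := f (map (s(d := ?x)) (d # rs)))"
        by (simp del: map_eq_conv)
    next
      fix r assume "r \<in> set (d # rs)"
      then show "r < Suc d" using rs[of r] by auto
    qed (use z in auto)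
    show "exec (P rs d ;; Q (d # rs) (Suc d) ;; clear_reg d ;; move_reg (Suc d) d) s (s(d := ?y))"
      by (rule exec.Seq[OF 1] exec.Seq[OF 2] exec.Seq[OF exec_clear[OF refl]] exec_move)+
        (use z in \<open>auto simp: fun_eq_iff\<close>)
  qed
qed

lemma comput_rec_env:
  assumes "comput z" "comput n" "comput f"
  shows "comput (\<lambda>e. rec_nat (z e) (\<lambda>i a. f (a # i # e)) (n e))"
proof -
  from comput_obtain[OF assms(1)] obtain Z where Z:
    "\<And>rs d s s'. (\<And>r. r \<in> set rs \<Longrightarrow> r < d) \<Longrightarrow> (\<And>i. i \<ge> d \<Longrightarrow> s i = 0) \<Longrightarrow>
     s' = s(d := z (map s rs)) \<Longrightarrow> exec (Z rs d) s s'" by blast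
  from comput_obtain[OF assms(2)] obtain N where N:
    "\<And>rs d s s'. (\<And>r. r \<in> set rs \<Longrightarrow> r < d) \<Longrightarrow> (\<And>i. i \<ge> d \<Longrightarrow> s i = 0) \<Longrightarrow>
     s' = s(d := n (map s rs)) \<Longrightarrow> exec (N rs d) s s'" by blast
  from comput_obtain[OF assms(3)] obtain Q where Q:
    "\<And>rs d s s'. (\<And>r. r \<in> set rs \<Longrightarrow> r < d) \<Longrightarrow> (\<And>i. i \<ge> d \<Longrightarrow> s i = 0) \<Longrightarrow>
     s' = s(d := f (map s rs)) \<Longrightarrow> exec (Q rs d) s s'" by blast
  \<comment> \<open>Stack frame of the loop: \<open>d\<close> counts the remaining rounds,
    \<open>d + 1\<close> holds the index, \<open>d + 2\<close> the accumulator, and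
    \<open>d + 3\<close> receives the new value.\<close>
  define B where "B rs d = Dec d ;; Q ((d + 2) # (d + 1) # rs) (d + 3) ;; clear_reg (d + 2) ;;
    move_reg (d + 3) (d + 2) ;; Inc (d + 1)" for rs d
  show ?thesis
  proof (rule computI[of "\<lambda>rs d. N rs d ;; Z rs (d + 2) ;; While d (B rs d) ;;
      clear_reg (d + 1) ;; move_reg (d + 2) d"])
    fix rs :: "nat list" and d and s :: store
    assume rs: "\<And>r. r \<in> set rs \<Longrightarrow> r < d" and z0: "\<And>i. i \<ge> d \<Longrightarrow> s i = 0"
    let ?e = "map s rs"
    define R where "R i = rec_nat (z ?e) (\<lambda>i a. f (a # i # ?e)) i" for i
    define S where "S m i a = s(d := m, d + 1 := i, d + 2 := a)" for m i a
    have env: "map (s(d := m, d + 1 := i, d + 2 := a)) rs = ?e" for m i a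
      using rs by (intro map_cong) force+
    have step: "exec (B rs d) (S (Suc m) i a) (S m (Suc i) (f (a # i # ?e)))" for m i a
    proof -
      have 1: "exec (Dec d) (S (Suc m) i a) (S m i a)"
        by (rule exec_Dec) (auto simp: S_def fun_eq_iff)
      have 2: "exec (Q ((d + 2) # (d + 1) # rs) (d + 3)) (S m i a)
          ((S m i a)(d + 3 := f (a # i # ?e)))"
      proof (rule Q)
        fix r assume "r \<in> set ((d + 2) # (d + 1) # rs)"
        then show "r < d + 3" using rs[of r] by auto
      next
        fix j assume "d + 3 \<le> j"
        then show "S m i a j = 0" using z0[of j] by (auto simp: S_def)
      qed (use env in \<open>simp add: S_def del: map_eq_conv\<close>)
      show ?thesis unfolding B_def
        by (rule exec.Seq[OF 1] exec.Seq[OF 2] exec.Seq[OF exec_clear[OF refl]]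
              exec.Seq[OF exec_move[OF _ refl]] exec_Inc)+
          (use z0 in \<open>auto intro!: exec_Inc simp: S_def fun_eq_iff\<close>)
    qed
    have loop: "exec (While d (B rs d)) (S m i (R i)) (S 0 (i + m) (R (i + m)))" for m i
    proof (induction m arbitrary: i)
      case 0
      then show ?case by (auto intro!: exec_While_zero simp: S_def)
    next
      case (Suc m)
      have "S (Suc m) i (R i) d \<noteq> 0" by (simp add: S_def)
      moreover have "f (R i # i # ?e) = R (Suc i)" by (simp add: R_def)
      ultimately show ?case
        using exec.While_step[where r = d, OF _ step[of m i "R i"]] Suc.IH[of "Suc i"] by simp
    qed
    have 1: "exec (N rs d) s (S (n ?e) 0 0)"
      by (rule N) (use rs z0 in \<open>auto simp: S_def fun_eq_iff\<close>)
    have 2: "exec (Z rs (d + 2)) (S (n ?e) 0 0) (S (n ?e) 0 (R 0))"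
    proof (rule Z)
      fix r assume "r \<in> set rs"
      then show "r < d + 2" using rs[of r] by auto
    next
      fix j assume "d + 2 \<le> j"
      then show "S (n ?e) 0 0 j = 0" using z0[of j] by (auto simp: S_def)
    qed (use env in \<open>simp add: S_def R_def del: map_eq_conv\<close>)
    show "exec (N rs d ;; Z rs (d + 2) ;; While d (B rs d) ;; clear_reg (d + 1) ;;
        move_reg (d + 2) d) s (s(d := rec_nat (z ?e) (\<lambda>i a. f (a # i # ?e)) (n ?e)))"
      by (rule exec.Seq[OF 1] exec.Seq[OF 2] exec.Seq[OF loop] exec.Seq[OF exec_clear[OF refl]]
            exec_move)+
        (use z0 in \<open>auto simp: S_def R_def fun_eq_iff\<close>)
  qed
qed

text \<open>Stated for a body in index, accumulator and environment, so that a
  \<open>rec_nat\<close> term matches directly. In the premise the bound variables become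
  \<open>arg 1\<close> and \<open>arg 0\<close>, with the old arguments behind two
  \<open>tl\<close>; together with \<open>arg_tl\<close>, later terms are then handled by their
  syntax alone.\<close>

lemma comput_rec:
  assumes "comput z" "comput n" "comput (\<lambda>e. f (arg 1 e) (arg 0 e) (tl (tl e)))"
  shows "comput (\<lambda>e. rec_nat (z e) (\<lambda>i a. f i a e) (n e))"
  using comput_rec_env[OF assms] by simp

text \<open>Unbounded search upwards from 0. A zero is required for every list, whatever its length,
  because the program must terminate on all of them.\<close>

lemma comput_Least:
  assumes f: "comput (\<lambda>e. f (arg 0 e) (tl e))" and ex: "\<And>e. \<exists>y. f y e = 0"
  shows "comput (\<lambda>e. LEAST y. f y e = 0)"
proof -
  from comput_obtain[OF f] obtain Q where Q:
    "\<And>rs d s s'. (\<And>r. r \<in> set rs \<Longrightarrow> r < d) \<Longrightarrow> (\<And>i. i \<ge> d \<Longrightarrow> s i = 0) \<Longrightarrow>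
     s' = s(d := f (arg 0 (map s rs)) (tl (map s rs))) \<Longrightarrow> exec (Q rs d) s s'" by blast
  show ?thesis
  proof (rule computI[of "\<lambda>rs d. Q (d # rs) (d + 1) ;;
      While (d + 1) (clear_reg (d + 1) ;; Inc d ;; Q (d # rs) (d + 1))"])
    fix rs :: "nat list" and d and s :: store
    assume rs: "\<And>r. r \<in> set rs \<Longrightarrow> r < d" and z0: "\<And>i. i \<ge> d \<Longrightarrow> s i = 0"
    let ?e = "map s rs"
    let ?y = "LEAST y. f y ?e = 0"
    define S where "S m a = s(d := m, d + 1 := a)" for m a
    have env: "map (s(d := m, Suc d := a)) rs = ?e" for m a
      using rs by (intro map_cong) force+
    have q: "exec (Q (d # rs) (d + 1)) (S m 0) (S m (f m ?e))" for m
    proof (rule Q)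
      fix r assume "r \<in> set (d # rs)"
      then show "r < d + 1" using rs[of r] by auto
    next
      fix j assume "d + 1 \<le> j"
      then show "S m 0 j = 0" using z0[of j] by (auto simp: S_def)
    qed (simp add: S_def env del: map_eq_conv)
    have loop: "exec (While (d + 1) (clear_reg (d + 1) ;; Inc d ;; Q (d # rs) (d + 1)))
        (S m (f m ?e)) (S ?y 0)" if "m \<le> ?y" for m
      using that
    proof (induction "?y - m" arbitrary: m)
      case 0
      then have "m = ?y" by simp
      moreover have "f ?y ?e = 0" using ex LeastI_ex by fast
      ultimately show ?case by (auto intro!: exec_While_zero simp: S_def)
    next
      case (Suc k)
      then have "m < ?y" by simp
      then have nz: "f m ?e \<noteq> 0" using not_less_Least by blast
      have eq: "(S m a)(d + 1 := 0, d := Suc (((S m a)(d + 1 := 0)) d)) = S (Suc m) 0" for a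
        by (auto simp: S_def fun_eq_iff)
      have "exec (clear_reg (d + 1) ;; Inc d ;; Q (d # rs) (d + 1))
          (S m (f m ?e)) (S (Suc m) (f (Suc m) ?e))"
        by (rule exec.Seq[OF exec_clear[OF refl]] exec.Seq[OF exec_Inc[OF refl]])+
          (use q[of "Suc m"] eq in simp)
      moreover have "exec (While (d + 1) (clear_reg (d + 1) ;; Inc d ;; Q (d # rs) (d + 1)))
        (S (Suc m) (f (Suc m) ?e)) (S ?y 0)"
        using Suc \<open>m < ?y\<close> by (intro Suc.hyps(1)) auto
      moreover have "S m (f m ?e) (d + 1) \<noteq> 0" using nz by (simp add: S_def)
      ultimately show ?case by (rule exec.While_step[rotated])
    qed
    have "S 0 0 = s" "S ?y 0 = s(d := ?y)" using z0 by (auto simp: S_def fun_eq_iff)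
    then show "exec (Q (d # rs) (d + 1) ;;
      While (d + 1) (clear_reg (d + 1) ;; Inc d ;; Q (d # rs) (d + 1))) s (s(d := ?y))"
      using exec.Seq[OF q[of 0] loop] by simp
  qed
qed

section \<open>Counter programs on Turing machines\<close>

fun nregs :: "prog \<Rightarrow> nat" where
  "nregs Skip = 0"
| "nregs (Inc r) = Suc r"
| "nregs (Dec r) = Suc r"
| "nregs (P ;; Q) = max (nregs P) (nregs Q)"
| "nregs (While r P) = max (Suc r) (nregs P)"

text \<open>
  The value of register \<open>r\<close> is the head position on tape \<open>r + 3\<close>, whose cell 0 is marked
  with symbol 3 to make the zero test possible.
\<close>

datatype instr = Mark | Read nat | INC nat | DEC nat | JZ nat nat | JMP nat | Write nat

fun psize :: "prog \<Rightarrow> nat" where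
  "psize Skip = 0"
| "psize (Inc r) = 1"
| "psize (Dec r) = 1"
| "psize (P ;; Q) = psize P + psize Q"
| "psize (While r P) = psize P + 2"

text \<open>Addresses are machine states, so jump targets are absolute and \<open>q\<close> must be
  the address at which the code is placed.\<close>

fun compile :: "prog \<Rightarrow> nat \<Rightarrow> instr list" where
  "compile Skip q = []"
| "compile (Inc r) q = [INC r]"
| "compile (Dec r) q = [DEC r]"
| "compile (P ;; Q) q = compile P q @ compile Q (q + psize P)"
| "compile (While r P) q = JZ r (q + psize P + 2) # compile P (Suc q) @ [JMP q]"

lemma length_compile [simp]: "length (compile P q) = psize P"
  by (induction P arbitrary: q) auto

definition keep :: "nat list \<Rightarrow> (nat \<times> move) list" where
  "keep syms = map (\<lambda>a. (a, Stay)) syms"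

text \<open>\<open>Read\<close> and \<open>Write\<close> are loops within a single state: they stay
  in \<open>q\<close> while a unary number is transferred between the input or output tape and a
  register, and pass to \<open>Suc q\<close> after the last 1.\<close>

fun instr_act :: "instr \<Rightarrow> nat \<Rightarrow> nat list \<Rightarrow> nat \<times> (nat \<times> move) list" where
  "instr_act Mark q ss = (Suc q, map (\<lambda>i. (if i < 3 then ss ! i else 3, Stay)) [0..<length ss])"
| "instr_act (Read r) q ss =
     (if ss ! 1 = 1 then (q, (keep ss)[1 := (1, MoveRight), r + 3 := (ss ! (r + 3), MoveRight)])
      else (Suc q, (keep ss)[1 := (ss ! 1, MoveRight)]))"
| "instr_act (INC r) q ss = (Suc q, (keep ss)[r + 3 := (ss ! (r + 3), MoveRight)])"
| "instr_act (DEC r) q ss = (Suc q, (keep ss)[r + 3 := (ss ! (r + 3), MoveLeft)])"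
| "instr_act (JZ r k) q ss = (if ss ! (r + 3) = 3 then k else Suc q, keep ss)"
| "instr_act (JMP k) q ss = (k, keep ss)"
| "instr_act (Write r) q ss =
     (if ss ! (r + 3) = 3 then (Suc q, (keep ss)[2 := (2, Stay)])
      else (q, (keep ss)[2 := (1, MoveRight), r + 3 := (ss ! (r + 3), MoveLeft)]))"

text \<open>The bound 3 on the symbols makes the table finite. A state outside the code has no
  entry, so running off the end of the code halts.\<close>

definition tm_of :: "instr list \<Rightarrow> nat \<Rightarrow> tm" where
  "tm_of code R = \<lparr> ntapes = R + 3,
     table = (\<lambda>(q, ss). if q < length code \<and> length ss = R + 3 \<and> set ss \<subseteq> {..3}
       then Some (instr_act (code ! q) q ss) else None) \<rparr>"

lemma table_tm_of:
  "q < length code \<Longrightarrow> length ss = R + 3 \<Longrightarrow> set ss \<subseteq> {..3} \<Longrightarrow>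
     table (tm_of code R) (q, ss) = Some (instr_act (code ! q) q ss)"
  by (simp add: tm_of_def)

lemma length_instr_act: "length (snd (instr_act a q ss)) = length ss"
  by (cases a) (auto simp: keep_def)

lemma is_tm_tm_of: "is_tm (tm_of code R)"
proof -
  have "dom (table (tm_of code R)) \<subseteq> {..<length code} \<times> {ss. set ss \<subseteq> {..3} \<and> length ss = R + 3}"
    by (auto simp: tm_of_def split: if_splits)
  then have "finite (dom (table (tm_of code R)))"
    by (rule finite_subset) (simp add: finite_lists_length_eq)
  moreover have "length acts = R + 3" if "instr_act a q ss = (q', acts)" "length ss = R + 3"
    for a q ss q' acts
    using length_instr_act[of a q ss] that by simp
  ultimately show ?thesis
    unfolding is_tm_def by (auto simp: tm_of_def split: if_splits)
qed

abbreviation steps :: "tm \<Rightarrow> config \<Rightarrow> config \<Rightarrow> bool" where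
  "steps M \<equiv> (\<lambda>a b. step M a = Some b)\<^sup>*\<^sup>*"

text \<open>\<open>p\<close> is the position on the input word and \<open>n\<close> the number of 1s
  written so far. Heads beyond tape \<open>R + 2\<close> follow the store too; instructions on
  registers below \<open>R\<close> leave them alone.\<close>

definition cfg :: "nat \<Rightarrow> nat list \<Rightarrow> nat \<Rightarrow> nat \<Rightarrow> nat \<Rightarrow> store \<Rightarrow> config" where
  "cfg R w q p n s = \<lparr> state = q,
     heads = (\<lambda>i. if i = 0 then 0 else if i = 1 then p else if i = 2 then n else s (i - 3)),
     tapes = (\<lambda>i. if i = 0 then blank_tape else if i = 1 then word_tape w
       else if i = 2 then word_tape (replicate n 1)
       else if i < R + 3 then blank_tape(0 := 3) else blank_tape) \<rparr>"

section \<open>Runs of compiled code\<close>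

context
  fixes code :: "instr list" and R :: nat and w :: "nat list"
  assumes w: "set w \<subseteq> {..3}"
begin

lemma word_tape_le: "word_tape w j \<le> 3"
  using w by (auto simp: word_tape_def dest: nth_mem)

lemma scanned_cfg:
  "scanned (tm_of code R) (cfg R w q p n s) =
     map (\<lambda>i. if i = 0 then 0 else if i = 1 then word_tape w p else if i = 2 then 0
       else if s (i - 3) = 0 then 3 else 0) [0..<R + 3]"
  by (auto simp: scanned_def cfg_def tm_of_def blank_tape_def word_tape_def)

lemma scanned_cfg_ok: "set (scanned (tm_of code R) (cfg R w q p n s)) \<subseteq> {..3}"
  using word_tape_le unfolding scanned_cfg by auto

lemma heads_cfg: "heads (cfg R w q p n s) i =
    (if i = 0 then 0 else if i = 1 then p else if i = 2 then n else s (i - 3))"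
  and tapes_cfg: "tapes (cfg R w q p n s) i = (if i = 0 then blank_tape else if i = 1 then word_tape w
    else if i = 2 then word_tape (replicate n 1)
    else if i < R + 3 then blank_tape(0 := 3) else blank_tape)"
  by (simp_all add: cfg_def)

text \<open>Reduces a machine step to a comparison tape by tape. The expected state
  \<open>q''\<close> is kept apart from \<open>q'\<close>, so that \<open>instr_act\<close> can be
  evaluated first and its result compared afterwards.\<close>

lemma step_cfg:
  assumes "q < length code"
    and "instr_act (code ! q) q (map (\<lambda>i. if i = 0 then 0 else if i = 1 then word_tape w p
      else if i = 2 then 0 else if s (i - 3) = 0 then 3 else 0) [0..<R + 3]) = (q', acts)"
    and "q' = q''"
    and "\<And>i. i < R + 3 \<Longrightarrow>
      move_head (snd (acts ! i)) (heads (cfg R w q p n s) i) = heads (cfg R w q'' p' n' s') i"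
    and "\<And>i. i \<ge> R + 3 \<Longrightarrow> heads (cfg R w q p n s) i = heads (cfg R w q'' p' n' s') i"
    and "\<And>i. i < R + 3 \<Longrightarrow> (tapes (cfg R w q p n s) i)(heads (cfg R w q p n s) i := fst (acts ! i))
      = tapes (cfg R w q'' p' n' s') i"
  shows "step (tm_of code R) (cfg R w q p n s) = Some (cfg R w q'' p' n' s')"
proof -
  let ?c = "cfg R w q p n s" and ?c' = "cfg R w q'' p' n' s'"
  have "table (tm_of code R) (q, scanned (tm_of code R) ?c) = Some (q'', acts)"
    using assms(1-3) scanned_cfg_ok[of q p n s]
    by (subst table_tm_of) (simp_all add: scanned_cfg)
  then have "table (tm_of code R) (state ?c, scanned (tm_of code R) ?c) = Some (q'', acts)"
    by (simp add: cfg_def)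
  moreover have nt: "ntapes (tm_of code R) = R + 3" by (simp add: tm_of_def)
  moreover have "(\<lambda>i. if i < R + 3 then move_head (snd (acts ! i)) (heads ?c i) else heads ?c i) = heads ?c'"
    using assms(4,5) by (intro ext) auto
  moreover have "(\<lambda>i. if i < R + 3 then (tapes ?c i)(heads ?c i := fst (acts ! i)) else tapes ?c i)
      = tapes ?c'"
  proof
    fix i
    show "(if i < R + 3 then (tapes ?c i)(heads ?c i := fst (acts ! i)) else tapes ?c i) = tapes ?c' i"
      using assms(6)[of i] by (cases "i < R + 3") (simp_all add: tapes_cfg)
  qed
  moreover have "\<lparr>state = q'', heads = heads ?c', tapes = tapes ?c'\<rparr> = ?c'"
    by (simp add: cfg_def)
  ultimately show ?thesis unfolding step_def by simp
qed

lemmas cfg_simps = keep_def nth_list_update heads_cfg tapes_cfg word_tape_def blank_tape_def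

lemma step_INC:
  assumes "q < length code" "code ! q = INC r" "r < R"
  shows "step (tm_of code R) (cfg R w q p n s) = Some (cfg R w (Suc q) p n (s(r := Suc (s r))))"
  by (rule step_cfg[OF assms(1)]) (use assms in \<open>auto simp: cfg_simps fun_eq_iff\<close>)

lemma step_DEC:
  assumes "q < length code" "code ! q = DEC r" "r < R"
  shows "step (tm_of code R) (cfg R w q p n s) = Some (cfg R w (Suc q) p n (s(r := s r - 1)))"
  by (rule step_cfg[OF assms(1)]) (use assms in \<open>auto simp: cfg_simps fun_eq_iff\<close>)

lemma step_JZ:
  assumes "q < length code" "code ! q = JZ r k" "r < R"
  shows "step (tm_of code R) (cfg R w q p n s) = Some (cfg R w (if s r = 0 then k else Suc q) p n s)"
  by (rule step_cfg[OF assms(1)]) (use assms in \<open>auto simp: cfg_simps fun_eq_iff\<close>)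

lemma step_JMP:
  assumes "q < length code" "code ! q = JMP k"
  shows "step (tm_of code R) (cfg R w q p n s) = Some (cfg R w k p n s)"
  by (rule step_cfg[OF assms(1)]) (use assms in \<open>auto simp: cfg_simps fun_eq_iff\<close>)

lemma step_Read_1:
  assumes "q < length code" "code ! q = Read r" "r < R" "word_tape w p = 1"
  shows "step (tm_of code R) (cfg R w q p n s) = Some (cfg R w q (Suc p) n (s(r := Suc (s r))))"
  by (rule step_cfg[OF assms(1)]) (use assms in \<open>auto simp: cfg_simps fun_eq_iff split: if_splits\<close>)

lemma step_Read_2:
  assumes "q < length code" "code ! q = Read r" "r < R" "word_tape w p = 2"
  shows "step (tm_of code R) (cfg R w q p n s) = Some (cfg R w (Suc q) (Suc p) n s)"
  by (rule step_cfg[OF assms(1)]) (use assms in \<open>auto simp: cfg_simps fun_eq_iff split: if_splits\<close>)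

lemma step_Write:
  assumes "q < length code" "code ! q = Write r" "r < R" "s r \<noteq> 0"
  shows "step (tm_of code R) (cfg R w q p n s) = Some (cfg R w q p (Suc n) (s(r := s r - 1)))"
  by (rule step_cfg[OF assms(1)])
    (use assms in \<open>auto simp: cfg_simps fun_eq_iff nth_append simp flip: replicate_append_same\<close>)

lemma steps_Read:
  assumes "q < length code" "code ! q = Read r" "r < R"
    and "\<And>i. i < x \<Longrightarrow> word_tape w (p + i) = 1" "word_tape w (p + x) = 2"
  shows "steps (tm_of code R) (cfg R w q p n s) (cfg R w (Suc q) (p + x + 1) n (s(r := s r + x)))"
  using assms(4,5)
proof (induction x arbitrary: p s)
  case 0
  then show ?case using step_Read_2[OF assms(1-3), of p n s] by auto
next
  case (Suc x)
  have 1: "step (tm_of code R) (cfg R w q p n s) = Some (cfg R w q (Suc p) n (s(r := Suc (s r))))"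
    using Suc.prems(1)[of 0] by (intro step_Read_1 assms) simp
  have 2: "steps (tm_of code R) (cfg R w q (Suc p) n (s(r := Suc (s r))))
     (cfg R w (Suc q) (Suc p + x + 1) n ((s(r := Suc (s r)))(r := (s(r := Suc (s r))) r + x)))"
  proof (rule Suc.IH)
    fix i assume "i < x" then show "word_tape w (Suc p + i) = 1" using Suc.prems(1)[of "Suc i"] by simp
  qed (use Suc.prems(2) in simp)
  have eq: "(s(r := Suc (s r)))(r := (s(r := Suc (s r))) r + x) = s(r := s r + Suc x)"
    "Suc p + x + 1 = p + Suc x + 1" by auto
  from converse_rtranclp_into_rtranclp[of "\<lambda>a b. step (tm_of code R) a = Some b", OF 1 2[unfolded eq]]
  show ?case .
qed

text \<open>The last configuration is not of the form \<open>cfg\<close>, because tape 2 then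
  carries the terminator 2; hence only its output tape is described. The machine halts there because
  \<open>Suc q\<close> is the length of the code.\<close>

lemma steps_Write:
  assumes "length code = Suc q" "code ! q = Write r" "r < R"
  shows "\<exists>c. halts_with (tm_of code R) (cfg R w q p n s) c \<and> tapes c 2 = word_tape (encode [n + s r])"
proof (induction "s r" arbitrary: n s)
  case 0
  let ?M = "tm_of code R" and ?c = "cfg R w q p n s"
  let ?ss = "scanned ?M ?c"
  have *: "?ss ! (r + 3) = 3" using assms 0 by (simp add: scanned_cfg)
  have len: "length ?ss = R + 3" by (simp add: scanned_def tm_of_def)
  have nt: "ntapes ?M = R + 3" by (simp add: tm_of_def)
  have "table ?M (state ?c, ?ss) = Some (Suc q, (keep ?ss)[2 := (2, Stay)])"
    using scanned_cfg_ok[of q p n s] assms * len by (simp add: tm_of_def cfg_def)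
  then obtain c where c: "step ?M ?c = Some c" "state c = Suc q"
    "tapes c = (\<lambda>i. if i < ntapes ?M
       then (tapes ?c i)(heads ?c i := fst ((keep ?ss)[2 := (2, Stay)] ! i)) else tapes ?c i)"
    unfolding step_def by simp
  have "step ?M c = None"
    using c(2) assms(1) by (simp add: step_def tm_of_def)
  moreover have "tapes c 2 = word_tape (encode [n])"
    using len unfolding c(3) nt
    by (auto simp: fun_eq_iff cfg_def word_tape_def keep_def encode_def nth_append)
  ultimately show ?case using c(1) 0[symmetric] unfolding halts_with_def by auto
next
  case (Suc x)
  have "x = (s(r := s r - 1)) r" using Suc.hyps(2) by simp
  from Suc.hyps(1)[where s = "s(r := s r - 1)" and n = "Suc n", OF this] obtain c where
    "halts_with (tm_of code R) (cfg R w q p (Suc n) (s(r := s r - 1))) c"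
    "tapes c 2 = word_tape (encode [Suc n + (s r - 1)])" by auto
  moreover have 1: "step (tm_of code R) (cfg R w q p n s) = Some (cfg R w q p (Suc n) (s(r := s r - 1)))"
    using Suc.hyps(2) assms by (intro step_Write) auto
  moreover have "Suc n + (s r - 1) = n + s r" using Suc.hyps(2) by simp
  ultimately show ?case
    using converse_rtranclp_into_rtranclp[of "\<lambda>a b. step (tm_of code R) a = Some b", OF 1]
    unfolding halts_with_def by (intro exI[of _ c]) simp
qed

definition code_at :: "nat \<Rightarrow> instr list \<Rightarrow> bool" where
  "code_at q xs \<longleftrightarrow> (\<exists>pre post. code = pre @ xs @ post \<and> length pre = q)"

lemma code_at_append: "code_at q (xs @ ys) \<Longrightarrow> code_at q xs \<and> code_at (q + length xs) ys"
proof -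
  assume "code_at q (xs @ ys)"
  then obtain pre post where "code = pre @ (xs @ ys) @ post" "length pre = q"
    unfolding code_at_def by blast
  then have "code = pre @ xs @ (ys @ post) \<and> length pre = q"
    "code = (pre @ xs) @ ys @ post \<and> length (pre @ xs) = q + length xs" by simp_all
  then show "code_at q xs \<and> code_at (q + length xs) ys"
    unfolding code_at_def by (intro conjI) ((rule exI)+, assumption)+
qed

lemma code_at_Cons: "code_at q (x # xs) \<Longrightarrow> q < length code \<and> code ! q = x \<and> code_at (Suc q) xs"
proof -
  assume at: "code_at q (x # xs)"
  then obtain pre post where "code = pre @ (x # xs) @ post" "length pre = q"
    unfolding code_at_def by (elim exE conjE)
  moreover from at have "code_at (Suc q) xs" using code_at_append[of q "[x]" xs] by simp
  ultimately show "q < length code \<and> code ! q = x \<and> code_at (Suc q) xs"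
    by (simp add: nth_append)
qed

text \<open>Induction over the run, not over the program: after one round of \<open>While\<close>
  the machine is back at the same address, and what remains is a shorter run of the same
  loop.\<close>

lemma steps_exec:
  assumes "exec P s s'" "nregs P \<le> R" "code_at q (compile P q)"
  shows "steps (tm_of code R) (cfg R w q p n s) (cfg R w (q + psize P) p n s')"
  using assms
proof (induction arbitrary: q rule: exec.induct)
  case (Inc r s)
  then have "q < length code" "code ! q = INC r" "r < R" by (auto dest!: code_at_Cons)
  from step_INC[OF this] show ?case by (simp add: r_into_rtranclp del: fun_upd_apply)
next
  case (Dec r s)
  then have "q < length code" "code ! q = DEC r" "r < R" by (auto dest!: code_at_Cons)
  from step_DEC[OF this] show ?case by (simp add: r_into_rtranclp del: fun_upd_apply)
next
  case (Seq P s s' Q s'')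
  have "code_at q (compile P q)" "code_at (q + psize P) (compile Q (q + psize P))"
    using code_at_append[OF Seq.prems(2)[simplified]] by simp_all
  then show ?case using Seq.IH(1)[of q] Seq.IH(2)[of "q + psize P"] Seq.prems(1)
    by (simp add: add.assoc)
next
  case (While_zero s r P)
  then show ?case using step_JZ[of q r _ p n s] by (auto dest!: code_at_Cons)
next
  case (While_step s r P s' s'')
  have c: "q < length code" "code ! q = JZ r (q + psize P + 2)" "code_at (Suc q) (compile P (Suc q))"
    "code_at (Suc q + psize P) [JMP q]"
    using code_at_Cons[OF While_step.prems(2)[simplified]]
      code_at_append[of "Suc q" "compile P (Suc q)" "[JMP q]"] by simp_all
  have "steps (tm_of code R) (cfg R w q p n s) (cfg R w (Suc q) p n s)"
    using step_JZ[OF c(1,2), of p n s] While_step.prems(1) While_step.hyps(1) by auto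
  moreover have "steps (tm_of code R) (cfg R w (Suc q) p n s) (cfg R w (Suc q + psize P) p n s')"
    using While_step.IH(1)[OF _ c(3)] While_step.prems(1) by simp
  moreover have "steps (tm_of code R) (cfg R w (Suc q + psize P) p n s') (cfg R w q p n s')"
    using step_JMP[of "Suc q + psize P" q p n s'] code_at_Cons[OF c(4)] by auto
  moreover have "steps (tm_of code R) (cfg R w q p n s') (cfg R w (q + psize (While r P)) p n s'')"
    by (rule While_step.IH(2)[OF While_step.prems])
  ultimately show ?case by (meson rtranclp_trans)
qed simp

end

lemma encode_Cons: "encode (x # xs) = replicate x 1 @ [2] @ encode xs"
  by (simp add: encode_def)

lemma encode_append: "encode (xs @ ys) = encode xs @ encode ys"
  by (simp add: encode_def)

lemma set_encode: "set (encode xs) \<subseteq> {1, 2}"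
  by (auto simp: encode_def)

lemma comput_imp_computes:
  assumes "comput f"
  shows "\<exists>M. is_tm M \<and> (\<forall>args. length args = a \<longrightarrow> computes M blank_tape args [f args])"
proof -
  from comput_obtain[OF assms] obtain P' where P':
    "\<And>rs d s s'. (\<And>r. r \<in> set rs \<Longrightarrow> r < d) \<Longrightarrow> (\<And>i. i \<ge> d \<Longrightarrow> s i = 0) \<Longrightarrow>
     s' = s(d := f (map s rs)) \<Longrightarrow> exec (P' rs d) s s'" by blast
  \<comment> \<open>The arguments occupy the registers below \<open>a\<close>, so the stack starts
    at \<open>a\<close> and the result is found there. \<open>R\<close> is at least
    \<open>Suc a\<close> so that this register has a tape even if the program never mentions
    it.\<close>
  define P where "P = P' [0..<a] a"
  define R where "R = max (nregs P) (Suc a)"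
  define code where "code = Mark # map Read [0..<a] @ compile P (Suc a) @ [Write a]"
  let ?M = "tm_of code R"
  have len: "length code = Suc (Suc (a + psize P))" by (simp add: code_def)
  have "computes ?M blank_tape args [f args]" if args: "length args = a" for args
  proof -
    let ?w = "encode args"
    have w: "set ?w \<subseteq> {..3}" using set_encode[of args] by auto
    define S where "S j i = (if i < j then args ! i else 0)" for i j
    have init: "step ?M (init_config blank_tape args) = Some (cfg R ?w 1 0 0 (S 0))"
    proof -
      let ?c = "init_config blank_tape args"
      have s: "scanned ?M ?c = map (\<lambda>i. if i = 1 then word_tape ?w 0 else 0) [0..<R + 3]"
        by (simp add: scanned_def init_config_def tm_of_def blank_tape_def)
      then have "set (scanned ?M ?c) \<subseteq> {..3}" using word_tape_le[OF w] by auto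
      then have "table ?M (state ?c, scanned ?M ?c) = Some (instr_act Mark 0 (scanned ?M ?c))"
        unfolding tm_of_def by (simp add: init_config_def code_def scanned_def)
      then show ?thesis unfolding step_def s
        by (auto simp: cfg_def init_config_def tm_of_def fun_eq_iff S_def blank_tape_def word_tape_def)
    qed
    have read: "steps ?M (cfg R ?w 1 0 0 (S 0)) (cfg R ?w (Suc j) (length (encode (take j args))) 0 (S j))"
      if "j \<le> a" for j
      using that
    proof (induction j)
      case 0
      then show ?case by (simp add: encode_def)
    next
      case (Suc j)
      let ?p = "length (encode (take j args))" and ?x = "args ! j"
      have w_eq: "?w = encode (take j args) @ replicate ?x 1 @ [2] @ encode (drop (Suc j) args)"
        using Suc.prems args by (metis Cons_nth_drop_Suc Suc_le_eq append_take_drop_id encode_Cons encode_append)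
      have "steps ?M (cfg R ?w (Suc j) ?p 0 (S j))
          (cfg R ?w (Suc (Suc j)) (?p + ?x + 1) 0 ((S j)(j := S j j + ?x)))"
      proof (rule steps_Read[OF w])
        show "code ! Suc j = Read j" using Suc.prems by (simp add: code_def nth_append)
        show "word_tape ?w (?p + i) = 1" if "i < ?x" for i
          using that unfolding w_eq word_tape_def by (simp add: nth_append)
        show "word_tape ?w (?p + ?x) = 2"
          unfolding w_eq word_tape_def by (simp add: nth_append)
      qed (use Suc.prems len in \<open>auto simp: R_def\<close>)
      moreover have "encode (take (Suc j) args) = encode (take j args) @ replicate ?x 1 @ [2]"
        using Suc.prems args by (simp add: take_Suc_conv_app_nth encode_append) (simp add: encode_def)
      moreover have "(S j)(j := S j j + ?x) = S (Suc j)" by (auto simp: S_def fun_eq_iff)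
      ultimately show ?case using Suc by simp
    qed
    let ?p = "length (encode (take a args))"
    have "exec P (S a) ((S a)(a := f args))"
      unfolding P_def
    proof (rule P')
      have "map (S a) [0..<a] = args" using args by (auto simp: S_def list_eq_iff_nth_eq)
      then show "(S a)(a := f args) = (S a)(a := f (map (S a) [0..<a]))" by simp
    qed (auto simp: S_def)
    moreover have "code_at code (Suc a) (compile P (Suc a))"
      unfolding code_at_def[OF w] code_def
      by (rule exI[of _ "Mark # map Read [0..<a]"]) simp
    ultimately have "steps ?M (cfg R ?w (Suc a) ?p 0 (S a))
        (cfg R ?w (Suc a + psize P) ?p 0 ((S a)(a := f args)))"
      by (intro steps_exec[OF w]) (auto simp: R_def)
    moreover obtain c where "halts_with ?M (cfg R ?w (Suc a + psize P) ?p 0 ((S a)(a := f args))) c"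
      "tapes c 2 = word_tape (encode [f args])"
    proof -
      have "code ! (Suc a + psize P) = Write a" by (simp add: code_def nth_append)
      then have "\<exists>c. halts_with ?M (cfg R ?w (Suc a + psize P) ?p 0 ((S a)(a := f args))) c \<and>
          tapes c 2 = word_tape (encode [0 + ((S a)(a := f args)) a])"
        using len by (intro steps_Write[OF w]) (simp_all add: R_def)
      then show thesis using that by auto
    qed
    ultimately show ?thesis
      unfolding computes_def halts_with_def using init read[of a]
      by (meson converse_rtranclp_into_rtranclp order_refl rtranclp_trans)
  qed
  then show ?thesis using is_tm_tm_of by blast
qed

lemma comput_imp_recursive1: "comput (\<lambda>e. f (arg 0 e)) \<Longrightarrow> recursive1 f"
  using comput_imp_computes[of "\<lambda>e. f (arg 0 e)" 1] unfolding recursive1_def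
  by (metis One_nat_def arg_simps(1) length_Cons list.size(3))

lemma comput_imp_recursive2: "comput (\<lambda>e. f (arg 0 e) (arg 1 e)) \<Longrightarrow> recursive2 f"
  using comput_imp_computes[of "\<lambda>e. f (arg 0 e) (arg 1 e)" 2] unfolding recursive2_def
  by (metis (no_types, lifting) One_nat_def arg_simps(1,2) length_Cons list.size(3) numeral_2_eq_2)

section \<open>Closure properties\<close>

lemma comput_const: "comput (\<lambda>e. c)"
  by (induction c) (use comput_zero comput_Suc in auto)

lemma comput_app1: "comput (\<lambda>e. F (arg 0 e)) \<Longrightarrow> comput f \<Longrightarrow> comput (\<lambda>e. F (f e))"
  using comput_let[of f "\<lambda>e. F (arg 0 e)"] by simp

lemma comput_app2:
  assumes "comput (\<lambda>e. F (arg 0 e) (arg 1 e))" "comput f" "comput g"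
  shows "comput (\<lambda>e. F (f e) (g e))"
  using comput_let[OF assms(3) comput_let[OF comput_tl[OF assms(2)] assms(1)]] by simp

lemma comput_app3:
  assumes "comput (\<lambda>e. F (arg 0 e) (arg 1 e) (arg 2 e))" "comput f" "comput g" "comput h"
  shows "comput (\<lambda>e. F (f e) (g e) (h e))"
  using comput_let[OF assms(4) comput_let[OF comput_tl[OF assms(3)]
      comput_let[OF comput_tl[OF comput_tl[OF assms(2)]] assms(1)]]]
  by (simp add: numeral_2_eq_2)

lemma comput_pred: "comput f \<Longrightarrow> comput (\<lambda>e. f e - 1)"
proof -
  have "rec_nat 0 (\<lambda>i a. i) n = n - 1" for n :: nat by (cases n) auto
  then show "comput f \<Longrightarrow> comput (\<lambda>e. f e - 1)"
    using comput_rec[of "\<lambda>e. 0" f "\<lambda>i a e. i"] comput_zero comput_arg by simp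
qed

lemma comput_add: "comput f \<Longrightarrow> comput g \<Longrightarrow> comput (\<lambda>e. f e + g e)"
proof -
  have "rec_nat m (\<lambda>i a. Suc a) n = m + n" for m n by (induction n) auto
  then show "comput f \<Longrightarrow> comput g \<Longrightarrow> comput (\<lambda>e. f e + g e)"
    using comput_rec[of f g "\<lambda>i a e. Suc a"] comput_Suc[OF comput_arg] by simp
qed

lemma comput_diff: "comput f \<Longrightarrow> comput g \<Longrightarrow> comput (\<lambda>e. f e - g e)"
proof -
  have "rec_nat m (\<lambda>i a. a - 1) n = m - n" for m n by (induction n) auto
  then show "comput f \<Longrightarrow> comput g \<Longrightarrow> comput (\<lambda>e. f e - g e)"
    using comput_rec[of f g "\<lambda>i a e. a - 1"] comput_pred[OF comput_arg] by simp
qed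

lemma comput_mult: "comput f \<Longrightarrow> comput g \<Longrightarrow> comput (\<lambda>e. f e * g e)"
proof -
  have "rec_nat 0 (\<lambda>i a. a + m) n = m * n" for m n by (induction n) auto
  then have "comput (\<lambda>e. arg 0 e * arg 1 e)"
    using comput_rec[of "\<lambda>e. 0" "arg 1" "\<lambda>i a e. a + arg 0 e"]
      comput_add[OF comput_arg comput_tl[OF comput_tl[OF comput_arg]]] comput_arg comput_zero by simp
  then show "comput f \<Longrightarrow> comput g \<Longrightarrow> comput (\<lambda>e. f e * g e)" by (rule comput_app2)
qed

lemma comput_power: "comput f \<Longrightarrow> comput g \<Longrightarrow> comput (\<lambda>e. f e ^ g e)"
proof -
  have "rec_nat 1 (\<lambda>i a. a * m) n = m ^ n" for m n :: nat by (induction n) auto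
  then have "comput (\<lambda>e. arg 0 e ^ arg 1 e)"
    using comput_rec[of "\<lambda>e. 1" "arg 1" "\<lambda>i a e. a * arg 0 e"]
      comput_mult[OF comput_arg comput_tl[OF comput_tl[OF comput_arg]]] comput_arg comput_const
    by simp
  then show "comput f \<Longrightarrow> comput g \<Longrightarrow> comput (\<lambda>e. f e ^ g e)" by (rule comput_app2)
qed

section \<open>Decidable predicates and bounded search\<close>

definition decid :: "(nat list \<Rightarrow> bool) \<Rightarrow> bool" where
  "decid P \<longleftrightarrow> comput (\<lambda>e. of_bool (P e))"

lemma decid_zero: "comput f \<Longrightarrow> decid (\<lambda>e. f e = 0)"
proof -
  have "of_bool (n = 0) = 1 - n" for n :: nat by (cases n) auto
  then show "comput f \<Longrightarrow> decid (\<lambda>e. f e = 0)"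
    unfolding decid_def by (simp add: comput_diff comput_const)
qed

lemma decid_le: "comput f \<Longrightarrow> comput g \<Longrightarrow> decid (\<lambda>e. f e \<le> g e)"
  using decid_zero[OF comput_diff[of f g]] by simp

lemma decid_less: "comput f \<Longrightarrow> comput g \<Longrightarrow> decid (\<lambda>e. f e < g e)"
  using decid_le[OF comput_Suc[of f], of g] by (simp add: Suc_le_eq)

lemma decid_not: "decid P \<Longrightarrow> decid (\<lambda>e. \<not> P e)"
proof -
  have "of_bool (\<not> b) = 1 - (of_bool b :: nat)" for b by simp
  then show "decid P \<Longrightarrow> decid (\<lambda>e. \<not> P e)"
    unfolding decid_def by (simp only:) (intro comput_diff comput_const)
qed

lemma decid_conj: "decid P \<Longrightarrow> decid Q \<Longrightarrow> decid (\<lambda>e. P e \<and> Q e)"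
  unfolding decid_def of_bool_conj by (intro comput_mult)

lemma decid_disj: "decid P \<Longrightarrow> decid Q \<Longrightarrow> decid (\<lambda>e. P e \<or> Q e)"
  using decid_not[OF decid_conj[OF decid_not decid_not], of P Q] by simp

lemma decid_eq: "comput f \<Longrightarrow> comput g \<Longrightarrow> decid (\<lambda>e. f e = g e)"
  unfolding eq_iff by (intro decid_conj decid_le)

lemma comput_if: "decid P \<Longrightarrow> comput f \<Longrightarrow> comput g \<Longrightarrow> comput (\<lambda>e. if P e then f e else g e)"
proof -
  have "(if b then m else n) = of_bool b * m + (1 - of_bool b) * n" for b and m n :: nat by simp
  then show "decid P \<Longrightarrow> comput f \<Longrightarrow> comput g \<Longrightarrow> comput (\<lambda>e. if P e then f e else g e)"
    unfolding decid_def by (simp only:) (intro comput_add comput_mult comput_diff comput_const)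
qed

lemma comput_of_bool: "decid P \<Longrightarrow> comput (\<lambda>e. of_bool (P e))"
  by (simp add: decid_def)

text \<open>Bounded sums also serve as bounded search: if at most one summand is nonzero, the sum
  selects its value.\<close>

lemma comput_sum:
  assumes "comput n" "comput (\<lambda>e. f (arg 0 e) (tl e))"
  shows "comput (\<lambda>e. \<Sum>i<n e. f i e)"
proof -
  have *: "rec_nat 0 (\<lambda>i a. a + f i e) m = (\<Sum>i<m. f i e)" for m e
    by (induction m) auto
  have "comput (\<lambda>e. arg 0 e + f (arg 1 e) (tl (tl e)))"
    using comput_add[OF comput_arg comput_tl[OF assms(2)], of 0] by (simp add: arg_tl)
  from comput_rec[OF comput_zero assms(1) this] show ?thesis by (simp add: *)
qed

lemma decid_bex:
  assumes "comput n" "decid (\<lambda>e. P (arg 0 e) (tl e))"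
  shows "decid (\<lambda>e. \<exists>i<n e. P i e)"
proof -
  have "(\<exists>i<m. P i e) \<longleftrightarrow> 0 < (\<Sum>i<m. of_bool (P i e) :: nat)" for m e
    by (auto simp: zero_less_iff_neq_zero)
  then show ?thesis
    by (simp only:) (intro decid_less comput_zero comput_sum assms(1) assms(2)[unfolded decid_def])
qed

lemma decid_even: "comput f \<Longrightarrow> decid (\<lambda>e. even (f e))"
proof -
  have "rec_nat 1 (\<lambda>i a. 1 - a) n = (of_bool (even n) :: nat)" for n :: nat
    by (induction n) (simp_all del: One_nat_def)
  then show "comput f \<Longrightarrow> decid (\<lambda>e. even (f e))"
    unfolding decid_def
    using comput_rec[of "\<lambda>e. 1" f "\<lambda>i a e. 1 - a"] comput_diff[OF comput_const comput_arg] comput_const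
    by simp
qed

lemmas comput_base = comput_const comput_arg comput_Suc comput_pred comput_add comput_diff comput_mult
  comput_power comput_if comput_sum comput_rec comput_of_bool decid_zero decid_eq decid_le decid_less
  decid_not decid_conj decid_disj decid_bex decid_even

lemma comput_div: "comput f \<Longrightarrow> comput g \<Longrightarrow> comput (\<lambda>e. f e div g e)"
proof -
  \<comment> \<open>The sum selects the only \<open>x\<close> with \<open>x * w \<le> m\<close> and
    \<open>m < Suc x * w\<close>. For \<open>w = 0\<close> no summand survives, in agreement with
    \<open>m div 0 = 0\<close>.\<close>
  have "m div w = (\<Sum>x<Suc m. if x * w \<le> m \<and> m < Suc x * w then x else 0)" for m w :: nat
  proof (cases "w = 0")
    case False
    have "x * w \<le> m \<and> m < Suc x * w \<longleftrightarrow> x = m div w" for x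
      using False by (metis div_less_iff_less_mult less_Suc_eq_le less_eq_div_iff_mult_less_eq
          linorder_not_le nle_le zero_less_iff_neq_zero)
    then have "(\<Sum>x<Suc m. if x * w \<le> m \<and> m < Suc x * w then x else 0)
        = (\<Sum>x<Suc m. if x = m div w then x else 0)" by simp
    also have "\<dots> = m div w" by (simp add: sum.delta div_le_dividend le_imp_less_Suc del: sum.lessThan_Suc)
    finally show ?thesis by simp
  qed simp
  then have "comput (\<lambda>e. arg 0 e div arg 1 e)"
    by (simp only:) (rule comput_base | simp only: arg_tl)+
  then show "comput f \<Longrightarrow> comput g \<Longrightarrow> comput (\<lambda>e. f e div g e)" by (rule comput_app2)
qed

lemma comput_mod: "comput f \<Longrightarrow> comput g \<Longrightarrow> comput (\<lambda>e. f e mod g e)"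
  unfolding modulo_nat_def by (intro comput_base comput_div)

lemma comput_pair: "comput f \<Longrightarrow> comput g \<Longrightarrow> comput (\<lambda>e. prod_encode (f e, g e))"
proof -
  have "triangle n = (\<Sum>i<Suc n. i)" for n by (induction n) auto
  then have "prod_encode (m, n) = (\<Sum>i<Suc (m + n). i) + m" for m n by (simp add: prod_encode_def)
  then have "comput (\<lambda>e. prod_encode (arg 0 e, arg 1 e))"
    by (simp only:) (rule comput_base | simp only: arg_tl)+
  then show "comput f \<Longrightarrow> comput g \<Longrightarrow> comput (\<lambda>e. prod_encode (f e, g e))" by (rule comput_app2)
qed

text \<open>Decoding by exhaustive search: both components are at most \<open>c\<close>, and
  injectivity of \<open>prod_encode\<close> leaves a single pair.\<close>

lemma prod_decode_sum:
  "h (prod_decode c) = (\<Sum>a<Suc c. \<Sum>b<Suc c. if prod_encode (a, b) = c then h (a, b) else 0 :: nat)"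
proof -
  obtain x y where xy: "prod_decode c = (x, y)" by (cases "prod_decode c")
  then have c: "c = prod_encode (x, y)" by (metis prod_decode_inverse)
  have eq: "prod_encode (a, b) = c \<longleftrightarrow> a = x \<and> b = y" for a b
    unfolding c by (simp add: prod_encode_eq)
  have le: "x < Suc c" "y < Suc c" using c le_prod_encode_1 le_prod_encode_2 by (auto simp: less_Suc_eq_le)
  have "(\<Sum>a<Suc c. \<Sum>b<Suc c. if prod_encode (a, b) = c then h (a, b) else 0)
      = (\<Sum>a<Suc c. if a = x then (\<Sum>b<Suc c. if b = y then h (a, b) else 0) else 0)"
    unfolding eq by (intro sum.cong) (auto intro!: sum.neutral)
  also have "\<dots> = h (x, y)" using le by (simp add: sum.delta del: sum.lessThan_Suc)
  finally show ?thesis by (simp only: xy)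
qed

lemma comput_fst: "comput f \<Longrightarrow> comput (\<lambda>e. fst (prod_decode (f e)))"
proof (rule comput_app1[of "\<lambda>c. fst (prod_decode c)"])
  show "comput (\<lambda>e. fst (prod_decode (arg 0 e)))"
    unfolding prod_decode_sum[where h = fst] fst_conv
    by (rule comput_base comput_pair | simp only: arg_tl)+
qed

lemma comput_snd: "comput f \<Longrightarrow> comput (\<lambda>e. snd (prod_decode (f e)))"
proof (rule comput_app1[of "\<lambda>c. snd (prod_decode c)"])
  show "comput (\<lambda>e. snd (prod_decode (arg 0 e)))"
    unfolding prod_decode_sum[where h = snd] snd_conv
    by (rule comput_base comput_pair | simp only: arg_tl)+
qed

lemmas comput_intros = comput_base comput_div comput_mod comput_pair comput_fst comput_snd

section \<open>Association lists coded as numbers\<close>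

text \<open>The first matching entry decides, so pushing a pair overrides older ones without
  deleting them.\<close>

definition look :: "nat \<Rightarrow> nat \<Rightarrow> nat \<Rightarrow> nat" where
  "look d k L = foldr (\<lambda>x a. if fst (prod_decode x) = k then snd (prod_decode x) else a) (list_decode L) d"

definition push :: "nat \<Rightarrow> nat \<Rightarrow> nat \<Rightarrow> nat" where
  "push k v L = Suc (prod_encode (prod_encode (k, v), L))"

lemma look_push [simp]: "look d k (push k' v L) = (if k' = k then v else look d k L)"
  by (simp add: look_def push_def)

lemma look_0 [simp]: "look d k 0 = d"
  by (simp add: look_def)

lemma look_exists:
  assumes "finite S"
  shows "\<exists>L. \<forall>k. look 0 k L = (if k \<in> S then f k else 0)"
  using assms
proof induction
  case empty
  then show ?case by (intro exI[of _ 0]) simp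
next
  case (insert x S)
  then obtain L where "\<forall>k. look 0 k L = (if k \<in> S then f k else 0)" by blast
  then show ?case by (intro exI[of _ "push x (f x) L"]) auto
qed

lemma rec_nat_cong:
  "(\<And>i a. i < n \<Longrightarrow> f i a = g i a) \<Longrightarrow> rec_nat z f n = rec_nat z g n"
  by (induction n) auto

definition tail_code :: "nat \<Rightarrow> nat \<Rightarrow> nat" where
  "tail_code c n = rec_nat c (\<lambda>i a. snd (prod_decode (a - 1))) n"

text \<open>Valid beyond the end of the list as well: the empty list has code 0, and
  \<open>prod_decode 0 = (0, 0)\<close> makes its tail 0 again.\<close>

lemma tail_code_list_encode: "tail_code (list_encode xs) n = list_encode (drop n xs)"
proof (induction n)
  case (Suc n)
  have "snd (prod_decode (list_encode ys - 1)) = list_encode (tl ys)" for ys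
  proof (cases ys)
    case Nil
    then show ?thesis using prod_encode_inverse[of "(0, 0)"] by (simp add: prod_encode_def)
  qed simp
  with Suc show ?case by (simp add: tail_code_def tl_drop drop_Suc)
qed (simp add: tail_code_def)

text \<open>\<open>foldr\<close> works from the back of the list, so round \<open>i\<close> treats
  position \<open>n - 1 - i\<close>. Positions beyond the end show code 0 and leave the accumulator
  alone; hence any \<open>n\<close> that bounds the length will do, in particular the code of the
  list itself.\<close>

lemma foldr_code:
  assumes "length xs \<le> n"
  shows "rec_nat z (\<lambda>i a. if tail_code (list_encode xs) (n - 1 - i) = 0 then a
       else s (fst (prod_decode (tail_code (list_encode xs) (n - 1 - i) - 1))) a) n = foldr s xs z"
  using assms
proof (induction n arbitrary: xs)
  case (Suc n)
  let ?f = "\<lambda>xs n i a. if tail_code (list_encode xs) (n - 1 - i) = 0 then a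
       else s (fst (prod_decode (tail_code (list_encode xs) (n - 1 - i) - 1))) a"
  have "rec_nat z (?f xs (Suc n)) n = rec_nat z (?f (tl xs) n) n"
  proof (rule rec_nat_cong)
    fix i a assume "i < n"
    then have "Suc n - 1 - i = Suc (n - 1 - i)" by simp
    then have "tail_code (list_encode xs) (Suc n - 1 - i) = tail_code (list_encode (tl xs)) (n - 1 - i)"
      by (simp only: tail_code_list_encode drop_Suc)
    then show "?f xs (Suc n) i a = ?f (tl xs) n i a" by (simp only:)
  qed
  also have "\<dots> = foldr s (tl xs) z" using Suc by (intro Suc.IH) auto
  finally have *: "rec_nat z (?f xs (Suc n)) n = foldr s (tl xs) z" .
  have "rec_nat z (?f xs (Suc n)) (Suc n) = ?f xs (Suc n) n (foldr s (tl xs) z)"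
    by (simp only: nat.rec * )
  also have "\<dots> = foldr s xs z"
    by (cases xs) (simp_all add: tail_code_def)
  finally show ?case .
qed simp

lemma length_list_decode: "length (list_decode c) \<le> c"
proof -
  have "length xs \<le> list_encode xs" for xs
  proof (induction xs)
    case (Cons x xs)
    then show ?case using le_prod_encode_2[of "list_encode xs" x] by simp
  qed simp
  from this[of "list_decode c"] show ?thesis by simp
qed

lemma comput_look:
  assumes "comput d" "comput k" "comput L"
  shows "comput (\<lambda>e. look (d e) (k e) (L e))"
proof (rule comput_app3[OF _ assms])
  have tail: "comput (\<lambda>e. tail_code (c e) (n e))" if "comput c" "comput n" for c n
    unfolding tail_code_def by (rule that comput_intros | simp only: arg_tl)+
  have "look d k L = rec_nat d (\<lambda>i a. if tail_code L (L - 1 - i) = 0 then a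
      else if fst (prod_decode (fst (prod_decode (tail_code L (L - 1 - i) - 1)))) = k
           then snd (prod_decode (fst (prod_decode (tail_code L (L - 1 - i) - 1)))) else a) L" for d k L
    using foldr_code[OF length_list_decode[of L], of d
        "\<lambda>x a. if fst (prod_decode x) = k then snd (prod_decode x) else a"]
    unfolding look_def list_decode_inverse by (rule sym)
  then show "comput (\<lambda>e. look (arg 0 e) (arg 1 e) (arg 2 e))"
    by (simp only:) (rule comput_intros tail | simp only: arg_tl)+
qed

lemma comput_push: "comput k \<Longrightarrow> comput v \<Longrightarrow> comput L \<Longrightarrow> comput (\<lambda>e. push (k e) (v e) (L e))"
  unfolding push_def by (intro comput_intros)

section \<open>Simulation of Turing machines\<close>

text \<open>
  A configuration is coded as the state paired with a log of all changes of heads and cells;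
  \<open>D\<close> supplies the initial contents, which makes infinite tapes harmless.
\<close>

definition headk :: "nat \<Rightarrow> nat" where
  "headk i = prod_encode (0, i)"

definition cellk :: "nat \<Rightarrow> nat \<Rightarrow> nat" where
  "cellk i j = prod_encode (Suc i, j)"

lemma key_simps [simp]:
  "headk i = headk j \<longleftrightarrow> i = j" "headk i \<noteq> cellk a b" "cellk a b \<noteq> headk i"
  "cellk i j = cellk a b \<longleftrightarrow> i = a \<and> j = b"
  by (auto simp: headk_def cellk_def)

definition rd :: "(nat \<Rightarrow> nat) \<Rightarrow> nat \<Rightarrow> nat \<Rightarrow> nat" where
  "rd D L k = look (D k) k L"

definition scan_code :: "(nat \<Rightarrow> nat) \<Rightarrow> nat \<Rightarrow> nat \<Rightarrow> nat" where
  "scan_code D L nt =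
     rec_nat 0 (\<lambda>i a. Suc (prod_encode (rd D L (cellk i (rd D L (headk i))), a))) nt"

text \<open>Each round puts the next symbol in front, so the symbols come out reversed; the keys in
  \<open>tm_code\<close> are reversed to match.\<close>

lemma scan_code_eq:
  "scan_code D L nt = list_encode (rev (map (\<lambda>i. rd D L (cellk i (rd D L (headk i)))) [0..<nt]))"
  unfolding scan_code_def by (induction nt) simp_all

fun move_code :: "move \<Rightarrow> nat" where
  "move_code MoveLeft = 0"
| "move_code Stay = 1"
| "move_code MoveRight = 2"

definition shift :: "nat \<Rightarrow> nat \<Rightarrow> nat" where
  "shift a h = (if a = 0 then h - 1 else if a = 1 then h else Suc h)"

lemma shift_move_code [simp]: "shift (move_code a) h = move_head a h"
  by (cases a) (simp_all add: shift_def)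

text \<open>All tapes act simultaneously: heads are read from the old log \<open>L\<close>
  throughout, and only \<open>a\<close> grows.\<close>

definition write_log :: "(nat \<Rightarrow> nat) \<Rightarrow> nat \<Rightarrow> nat \<Rightarrow> nat \<Rightarrow> nat" where
  "write_log D L A nt = rec_nat L (\<lambda>i a.
     push (headk i) (shift (snd (prod_decode (look 0 i A))) (rd D L (headk i)))
       (push (cellk i (rd D L (headk i))) (fst (prod_decode (look 0 i A))) a)) nt"

lemma look_write_log:
  "look d (headk i) (write_log D L A nt) =
     (if i < nt then shift (snd (prod_decode (look 0 i A))) (rd D L (headk i)) else look d (headk i) L)"
  "look d (cellk i j) (write_log D L A nt) =
     (if i < nt \<and> j = rd D L (headk i) then fst (prod_decode (look 0 i A)) else look d (cellk i j) L)"
  unfolding write_log_def by (induction nt) (auto simp: less_Suc_eq)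

text \<open>Value 0 means that no transition applies; otherwise the value is \<open>Suc\<close> of
  the coded new state and actions.\<close>

definition entry :: "(nat \<Rightarrow> nat) \<Rightarrow> nat \<Rightarrow> nat \<Rightarrow> nat" where
  "entry D z c = look 0 (prod_encode (fst (prod_decode c),
     scan_code D (snd (prod_decode c)) (fst (prod_decode z)))) (snd (prod_decode z))"

text \<open>A halted configuration is a fixed point, so running the simulation too long does no
  harm.\<close>

definition next_code :: "(nat \<Rightarrow> nat) \<Rightarrow> nat \<Rightarrow> nat \<Rightarrow> nat" where
  "next_code D z c = (if entry D z c = 0 then c else
     prod_encode (fst (prod_decode (entry D z c - 1)),
       write_log D (snd (prod_decode c)) (snd (prod_decode (entry D z c - 1))) (fst (prod_decode z))))"

text \<open>Code 0 is the initial configuration, since \<open>prod_decode 0 = (0, 0)\<close> gives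
  state 0 and an empty log.\<close>

definition sim :: "(nat \<Rightarrow> nat) \<Rightarrow> nat \<Rightarrow> nat \<Rightarrow> nat" where
  "sim D z t = rec_nat 0 (\<lambda>_ c. next_code D z c) t"

context
  fixes D :: "nat \<Rightarrow> nat \<Rightarrow> nat"
  assumes D: "comput (\<lambda>e. D (arg 0 e) (arg 1 e))"
begin

lemma comput_rd:
  "comput p \<Longrightarrow> comput L \<Longrightarrow> comput k \<Longrightarrow> comput (\<lambda>e. rd (D (p e)) (L e) (k e))"
  unfolding rd_def by (intro comput_look comput_app2[OF D])

lemma comput_entry:
  assumes "comput p" "comput z" "comput c"
  shows "comput (\<lambda>e. entry (D (p e)) (z e) (c e))"
proof (rule comput_app3[OF _ assms])
  show "comput (\<lambda>e. entry (D (arg 0 e)) (arg 1 e) (arg 2 e))"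
    unfolding entry_def scan_code_def headk_def cellk_def
    by (rule comput_look comput_rd comput_intros | simp only: arg_tl)+
qed

lemma comput_next_code:
  assumes "comput p" "comput z" "comput c"
  shows "comput (\<lambda>e. next_code (D (p e)) (z e) (c e))"
proof (rule comput_app3[OF _ assms])
  show "comput (\<lambda>e. next_code (D (arg 0 e)) (arg 1 e) (arg 2 e))"
    unfolding next_code_def write_log_def headk_def cellk_def shift_def
    by (rule comput_look comput_rd comput_entry comput_push comput_intros | simp only: arg_tl)+
qed

lemma comput_sim:
  assumes "comput p" "comput z" "comput t"
  shows "comput (\<lambda>e. sim (D (p e)) (z e) (t e))"
proof (rule comput_app3[OF _ assms])
  show "comput (\<lambda>e. sim (D (arg 0 e)) (arg 1 e) (arg 2 e))"
    unfolding sim_def by (rule comput_next_code comput_intros | simp only: arg_tl)+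
qed

end

definition tm_code :: "nat \<Rightarrow> tm \<Rightarrow> bool" where
  "tm_code z M \<longleftrightarrow> fst (prod_decode z) = ntapes M \<and>
     (\<forall>q ss. length ss = ntapes M \<longrightarrow>
        (case table M (q, ss) of
           None \<Rightarrow> look 0 (prod_encode (q, list_encode (rev ss))) (snd (prod_decode z)) = 0
         | Some (q', acts) \<Rightarrow>
             \<exists>A. look 0 (prod_encode (q, list_encode (rev ss))) (snd (prod_decode z)) =
                   Suc (prod_encode (q', A)) \<and>
                 (\<forall>i<ntapes M. look 0 i A = prod_encode (fst (acts ! i), move_code (snd (acts ! i))))))"

lemma tm_code_exists:
  assumes "is_tm M"
  shows "\<exists>z. tm_code z M"
proof -
  have "\<exists>A. \<forall>i<n. look 0 i A = prod_encode (fst (acts ! i), move_code (snd (acts ! i)))" for acts n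
  proof -
    define f where "f i = prod_encode (fst (acts ! i), move_code (snd (acts ! i)))" for i
    obtain L where "\<forall>k. look 0 k L = (if k \<in> {..<n} then f k else 0)"
      using look_exists[OF finite_lessThan, of n f] by (rule exE)
    then show ?thesis by (intro exI[of _ L]) (simp add: f_def)
  qed
  then have "\<forall>acts. \<exists>A. \<forall>i<ntapes M.
      look 0 i A = prod_encode (fst (acts ! i), move_code (snd (acts ! i)))" by simp
  from choice[OF this] obtain A where A: "\<And>acts i. i < ntapes M \<Longrightarrow>
      look 0 i (A acts) = prod_encode (fst (acts ! i), move_code (snd (acts ! i)))"
    by blast
  define key where "key = (\<lambda>(q, ss). prod_encode (q, list_encode (rev ss)))"
  define val where "val k = (case table M (fst (prod_decode k), rev (list_decode (snd (prod_decode k)))) of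
      None \<Rightarrow> 0 | Some (q', acts) \<Rightarrow> Suc (prod_encode (q', A acts)))" for k
  have "finite (key ` dom (table M))" using assms by (simp add: is_tm_def)
  from look_exists[OF this, of val] obtain L where
    L: "\<And>k. look 0 k L = (if k \<in> key ` dom (table M) then val k else 0)" by blast
  \<comment> \<open>\<open>val\<close> decodes the key itself, so no two transitions can interfere
    under \<open>key\<close>.\<close>
  have val_key: "val (key (q, ss)) = (case table M (q, ss) of
      None \<Rightarrow> 0 | Some (q', acts) \<Rightarrow> Suc (prod_encode (q', A acts)))" for q ss
    by (simp add: val_def key_def)
  have "look 0 (key (q, ss)) L = val (key (q, ss))" for q ss
    unfolding L val_key by (auto split: option.split)
  then have "tm_code (prod_encode (ntapes M, L)) M"
    unfolding tm_code_def using A val_key by (auto simp: key_def split: option.split)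
  then show ?thesis by blast
qed

definition repr :: "(nat \<Rightarrow> nat) \<Rightarrow> config \<Rightarrow> nat \<Rightarrow> bool" where
  "repr D c n \<longleftrightarrow> state c = fst (prod_decode n) \<and>
     (\<forall>i. heads c i = rd D (snd (prod_decode n)) (headk i)) \<and>
     (\<forall>i j. tapes c i j = rd D (snd (prod_decode n)) (cellk i j))"

lemma repr_step:
  assumes "is_tm M" "tm_code z M" "repr D c n"
  shows "step M c = None \<Longrightarrow> entry D z n = 0"
    and "step M c = Some c' \<Longrightarrow> entry D z n \<noteq> 0 \<and> repr D c' (next_code D z n)"
proof -
  let ?ss = "scanned M c" and ?L = "snd (prod_decode n)"
  have len: "length ?ss = ntapes M" by (simp add: scanned_def)
  have nt: "fst (prod_decode z) = ntapes M" using assms(2) by (simp add: tm_code_def)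
  have "scan_code D ?L (ntapes M) = list_encode (rev ?ss)"
    using assms(3) by (simp add: scan_code_eq scanned_def repr_def)
  then have e: "entry D z n = look 0 (prod_encode (state c, list_encode (rev ?ss))) (snd (prod_decode z))"
    using assms(3) by (simp add: entry_def nt repr_def)
  note code = assms(2)[unfolded tm_code_def, THEN conjunct2, rule_format, OF len, of "state c"]
  show "entry D z n = 0" if "step M c = None"
    using that code unfolding e step_def by (auto split: option.splits)
  show "entry D z n \<noteq> 0 \<and> repr D c' (next_code D z n)" if s: "step M c = Some c'"
  proof -
    from s obtain q' acts where t: "table M (state c, ?ss) = Some (q', acts)"
      and c': "c' = \<lparr> state = q',
        heads = (\<lambda>i. if i < ntapes M then move_head (snd (acts ! i)) (heads c i) else heads c i),
        tapes = (\<lambda>i. if i < ntapes M then (tapes c i)(heads c i := fst (acts ! i)) else tapes c i) \<rparr>"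
      unfolding step_def by (auto split: option.splits)
    from code[unfolded t] obtain A where A: "entry D z n = Suc (prod_encode (q', A))"
      "\<And>i. i < ntapes M \<Longrightarrow> look 0 i A = prod_encode (fst (acts ! i), move_code (snd (acts ! i)))"
      unfolding e by auto
    have "next_code D z n = prod_encode (q', write_log D ?L A (ntapes M))"
      unfolding next_code_def A(1) nt by simp
    then show ?thesis
      using A assms(3) by (auto simp: repr_def c' rd_def look_write_log)
  qed
qed

text \<open>Before time \<open>k\<close> a transition applies, and from \<open>k\<close> on the code
  is a fixed point. The equivalence for all \<open>t\<close> lets \<open>LEAST\<close> recover the
  halting time and makes halting visible at every later time.\<close>

lemma sim_halts:
  assumes M: "is_tm M" "tm_code z M" and init: "repr D c 0" and halt: "halts_with M c c'"
  obtains k where "\<And>t. entry D z (sim D z t) = 0 \<longleftrightarrow> k \<le> t" "\<And>t. k \<le> t \<Longrightarrow> repr D c' (sim D z t)"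
proof -
  from halt obtain k where k: "((\<lambda>a b. step M a = Some b) ^^ k) c c'" and end_: "step M c' = None"
    unfolding halts_with_def by (metis rtranclp_imp_relpowp)
  from k obtain f where f: "f 0 = c" "f k = c'" "\<And>i. i < k \<Longrightarrow> step M (f i) = Some (f (Suc i))"
    unfolding relpowp_fun_conv by blast
  have Suc: "sim D z (Suc t) = next_code D z (sim D z t)" for t by (simp add: sim_def)
  have r: "repr D (f t) (sim D z t)" if "t \<le> k" for t
    using that
  proof (induction t)
    case 0
    then show ?case using init f(1) by (simp add: sim_def)
  next
    case (Suc t)
    then show ?case using repr_step(2)[OF M, of D "f t" "sim D z t"] f(3)[of t]
      by (simp add: \<open>sim D z (Suc t) = _\<close>)
  qed
  have e: "entry D z (sim D z k) = 0"
    using repr_step(1)[OF M r[OF order_refl]] end_ f(2) by simp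
  have stay: "sim D z (k + i) = sim D z k" for i
    by (induction i) (simp_all add: Suc next_code_def e)
  show thesis
  proof
    fix t
    show "entry D z (sim D z t) = 0 \<longleftrightarrow> k \<le> t"
    proof (cases "k \<le> t")
      case True
      then show ?thesis using stay[of "t - k"] e by simp
    next
      case False
      then show ?thesis using repr_step(2)[OF M r[of t]] f(3)[of t] by auto
    qed
    assume "k \<le> t"
    then show "repr D c' (sim D z t)" using stay[of "t - k"] r[of k] f(2) by simp
  qed
qed

text \<open>By \<open>cellk\<close>, the first components 1 and 2 of a key belong to tapes 0 and 1;
  heads and all other cells start at 0.\<close>

definition contents :: "(nat \<Rightarrow> nat) \<Rightarrow> (nat \<Rightarrow> nat) \<Rightarrow> nat \<Rightarrow> nat" where
  "contents T W key = (if fst (prod_decode key) = 1 then T (snd (prod_decode key))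
     else if fst (prod_decode key) = 2 then W (snd (prod_decode key)) else 0)"

lemma repr_init: "repr (contents T (word_tape (encode args))) (init_config T args) 0"
proof -
  have "prod_decode 0 = (0, 0)" using prod_encode_inverse[of "(0, 0)"] by (simp add: prod_encode_def)
  then show ?thesis
    by (auto simp: repr_def init_config_def rd_def contents_def headk_def cellk_def blank_tape_def)
qed

lemma computes_sim:
  assumes "is_tm M" "tm_code z M" "computes M T args out"
  defines "D \<equiv> contents T (word_tape (encode args))"
  obtains k where "\<And>t. entry D z (sim D z t) = 0 \<longleftrightarrow> k \<le> t"
    "\<And>t j. k \<le> t \<Longrightarrow> rd D (snd (prod_decode (sim D z t))) (cellk 2 j) = word_tape (encode out) j"
proof -
  from assms(3) obtain c where c: "halts_with M (init_config T args) c" "tapes c 2 = word_tape (encode out)"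
    unfolding computes_def by blast
  from sim_halts[OF assms(1,2) repr_init c(1)] obtain k where
    k: "\<And>t. entry D z (sim D z t) = 0 \<longleftrightarrow> k \<le> t" "\<And>t. k \<le> t \<Longrightarrow> repr D c (sim D z t)"
    unfolding D_def by metis
  show thesis
  proof
    show "rd D (snd (prod_decode (sim D z t))) (cellk 2 j) = word_tape (encode out) j" if "k \<le> t" for t j
      using k(2)[OF that] c(2) unfolding repr_def by metis
  qed (rule k(1))
qed

text \<open>The \<open>l\<close>-th number on a tape, read off as the number of 1s that follow exactly \<open>l\<close> 2s.\<close>

definition parse :: "(nat \<Rightarrow> nat) \<Rightarrow> nat \<Rightarrow> nat \<Rightarrow> nat" where
  "parse f b l = (\<Sum>j<b. of_bool (f j = 1 \<and> (\<Sum>i<j. of_bool (f i = 2)) = l))"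

lemma sum_lessThan_add: "(\<Sum>i<m + n. f i) = (\<Sum>i<m. f i) + (\<Sum>i<n. f (m + i))" for f :: "nat \<Rightarrow> nat"
  by (induction n) (simp_all add: add.assoc)

text \<open>Induction from the right: counting the 2s before a cell concerns only the prefix, so an
  appended number leaves all earlier contributions unchanged, and its own 1s are preceded by exactly
  \<open>length xs\<close> 2s.\<close>

lemma parse_encode: "parse (word_tape (encode xs)) (length (encode xs)) l = arg l xs"
proof (induction xs rule: rev_induct)
  case Nil
  then show ?case by (simp add: parse_def encode_def)
next
  case (snoc x xs)
  let ?w = "encode xs" and ?f = "word_tape (encode (xs @ [x]))"
  have w: "encode (xs @ [x]) = ?w @ replicate x 1 @ [2]" by (simp add: encode_def)
  have f1: "?f j = word_tape ?w j" if "j < length ?w" for j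
    using that by (simp add: w word_tape_def nth_append)
  have f2: "?f (length ?w + j) = 1" if "j < x" for j
    using that by (simp add: w word_tape_def nth_append)
  have f3: "?f (length ?w + x) = 2" by (simp add: w word_tape_def nth_append)
  have cnt: "(\<Sum>i<length (encode ys). of_bool (word_tape (encode ys) i = 2)) = length ys" for ys
  proof (induction ys rule: rev_induct)
    case (snoc y ys)
    have w': "encode (ys @ [y]) = encode ys @ replicate y 1 @ [2]" by (simp add: encode_def)
    have "(\<Sum>i<length (encode ys). of_bool (word_tape (encode (ys @ [y])) i = 2)) =
       (\<Sum>i<length (encode ys). of_bool (word_tape (encode ys) i = 2) :: nat)"
      by (rule sum.cong) (auto simp: w' word_tape_def nth_append)
    moreover have "(\<Sum>i<Suc y. of_bool (word_tape (encode (ys @ [y])) (length (encode ys) + i) = 2)) = (1 :: nat)"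
      by (auto simp: w' word_tape_def nth_append intro!: sum.neutral)
    moreover have "length (encode (ys @ [y])) = length (encode ys) + Suc y" by (simp add: w')
    ultimately show ?case using snoc by (simp only: sum_lessThan_add) simp
  qed (simp add: encode_def)
  have cntf: "(\<Sum>i<length ?w + j. of_bool (?f i = 2)) = length xs" if "j \<le> x" for j
  proof -
    have "(\<Sum>i<length ?w. of_bool (?f i = 2)) = length xs"
      using cnt[of xs] f1 by (simp cong: sum.cong_simp)
    moreover have "(\<Sum>i<j. of_bool (?f (length ?w + i) = 2)) = (0 :: nat)"
      using f2 that by (intro sum.neutral) auto
    ultimately show ?thesis by (simp only: sum_lessThan_add)
  qed
  have "parse ?f (length ?w) l = parse (word_tape ?w) (length ?w) l"
    unfolding parse_def by (intro sum.cong refl) (use f1 in \<open>auto cong: sum.cong_simp\<close>)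
  moreover have "parse g (Suc b) l = parse g b l + of_bool (g b = 1 \<and> (\<Sum>i<b. of_bool (g i = 2)) = l)"
    for g b by (simp add: parse_def)
  ultimately have "parse ?f (length ?w + j) l = arg l xs + (if l = length xs then j else 0)"
    if "j \<le> x" for j
    using that
  proof (induction j)
    case (Suc j)
    then show ?case using f2[of j] cntf[of j] by simp
  qed (use snoc in simp)
  from this[of x] have "parse ?f (length (encode (xs @ [x]))) l
      = arg l xs + (if l = length xs then x else 0)"
    using f3 by (simp add: w parse_def)
  then show ?case by (auto simp: arg_def nth_append less_Suc_eq)
qed

lemma Least_word_tape: "(LEAST y. word_tape (encode xs) y = 0) = length (encode xs)"
proof (rule Least_equality)
  fix y assume "word_tape (encode xs) y = 0"
  then show "length (encode xs) \<le> y"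
    using set_encode[of xs] nth_mem[of y "encode xs"] by (fastforce simp: word_tape_def split: if_splits)
qed (simp add: word_tape_def)

text \<open>The bridge from machines back to programs, uniform in a parameter \<open>p\<close> on
  which stream tape and arguments may depend. Halting for every \<open>p\<close> is what justifies
  the search for the halting time.\<close>

lemma comput_computes:
  assumes M: "is_tm M" "\<And>p. computes M (T p) (args p) (out p)"
    and T: "comput (\<lambda>e. T (arg 0 e) (arg 1 e))"
    and W: "comput (\<lambda>e. word_tape (encode (args (arg 0 e))) (arg 1 e))"
  shows "comput (\<lambda>e. arg l (out (arg 0 e)))"
proof -
  from tm_code_exists[OF M(1)] obtain z where z: "tm_code z M" by blast
  define D where "D p = contents (T p) (word_tape (encode (args p)))" for p
  have D: "comput (\<lambda>e. D (arg 0 e) (arg 1 e))"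
    unfolding D_def contents_def
    by (rule comput_app2[OF T] comput_app2[OF W] comput_intros | simp only: arg_tl)+
  have run: "\<exists>k. (\<forall>t. entry (D p) z (sim (D p) z t) = 0 \<longleftrightarrow> k \<le> t) \<and>
    (\<forall>t j. k \<le> t \<longrightarrow> rd (D p) (snd (prod_decode (sim (D p) z t))) (cellk 2 j) = word_tape (encode (out p)) j)" for p
    using computes_sim[OF M(1) z M(2)[of p]] unfolding D_def by metis
  define t where "t p = (LEAST t. entry (D p) z (sim (D p) z t) = 0)" for p
  have t: "comput (\<lambda>e. t (arg 0 e))"
    unfolding t_def
  proof (rule comput_Least)
    show "\<exists>y. entry (D (arg 0 e)) z (sim (D (arg 0 e)) z y) = 0" for e using run by blast
  qed (rule comput_entry[OF D] comput_sim[OF D] comput_intros | simp only: arg_tl)+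
  define cells where "cells p j = rd (D p) (snd (prod_decode (sim (D p) z (t p)))) (cellk 2 j)" for p j
  have cells_eq: "cells p = word_tape (encode (out p))" for p
  proof -
    from run[of p] obtain k where k: "\<And>t. entry (D p) z (sim (D p) z t) = 0 \<longleftrightarrow> k \<le> t"
      "\<And>t j. k \<le> t \<Longrightarrow> rd (D p) (snd (prod_decode (sim (D p) z t))) (cellk 2 j) = word_tape (encode (out p)) j"
      by blast
    have "t p = k" unfolding t_def k(1) by (rule Least_equality) auto
    then show ?thesis unfolding cells_def using k(2) by auto
  qed
  have cells: "comput (\<lambda>e. cells (arg 0 e) (arg 1 e))"
    unfolding cells_def cellk_def
    by (rule comput_rd[OF D] comput_sim[OF D] comput_app1[OF t] comput_intros | simp only: arg_tl)+
  \<comment> \<open>The output ends at the first blank, since \<open>encode\<close> uses only the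
    symbols 1 and 2; this is the bound for \<open>parse\<close>.\<close>
  define b where "b p = (LEAST y. cells p y = 0)" for p
  have b: "comput (\<lambda>e. b (arg 0 e))"
    unfolding b_def
  proof (rule comput_Least)
    show "\<exists>y. cells (arg 0 e) y = 0" for e
      unfolding cells_eq by (rule exI[of _ "length (encode (out (arg 0 e)))"]) (simp add: word_tape_def)
  qed (rule comput_app2[OF cells] comput_intros | simp only: arg_tl)+
  have "arg l (out p) = parse (cells p) (b p) l" for p
    unfolding b_def cells_eq Least_word_tape by (simp add: parse_encode)
  then show ?thesis
    unfolding parse_def
    by (simp only:) (rule comput_app2[OF cells] comput_app1[OF b] comput_intros | simp only: arg_tl)+
qed

section \<open>From recursive functions to counter programs\<close>

lemma word_tape_encode_single:
  "word_tape (encode [n]) j = (if j < n then 1 else if j = n then 2 else 0)"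
  by (auto simp: word_tape_def encode_def nth_append)

lemma recursive1_imp_comput:
  assumes "recursive1 f"
  shows "comput (\<lambda>e. f (arg 0 e))"
proof -
  from assms obtain M where M: "is_tm M" "\<And>n. computes M blank_tape [n] [f n]"
    unfolding recursive1_def by blast
  have "comput (\<lambda>e. word_tape (encode [arg 0 e]) (arg 1 e))"
    unfolding word_tape_encode_single by (rule comput_intros)+
  then show ?thesis
    using comput_computes[of M "\<lambda>_. blank_tape" "\<lambda>n. [n]" "\<lambda>n. [f n]" 0] M comput_zero
    by (simp add: blank_tape_def)
qed

lemma recursive2_imp_comput:
  assumes "recursive2 f"
  shows "comput (\<lambda>e. f (arg 0 e) (arg 1 e))"
proof -
  from assms obtain M where M: "is_tm M" "\<And>n k. computes M blank_tape [n, k] [f n k]"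
    unfolding recursive2_def by blast
  have "word_tape (encode [n, k]) j = (if j < n then 1 else if j = n then 2 else
      if j < n + 1 + k then 1 else if j = n + 1 + k then 2 else 0)" for n k j
    by (auto simp: word_tape_def encode_def nth_append nth_Cons split: nat.split)
  \<comment> \<open>Both arguments are packed into the single parameter of
    \<open>comput_computes\<close>.\<close>
  then have "comput (\<lambda>e. word_tape (encode [fst (prod_decode (arg 0 e)), snd (prod_decode (arg 0 e))]) (arg 1 e))"
    by (simp only:) (rule comput_intros)+
  then have "comput (\<lambda>e. f (fst (prod_decode (arg 0 e))) (snd (prod_decode (arg 0 e))))"
    using comput_computes[of M "\<lambda>_. blank_tape" "\<lambda>p. [fst (prod_decode p), snd (prod_decode p)]"
        "\<lambda>p. [f (fst (prod_decode p)) (snd (prod_decode p))]" 0] M comput_zero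
    by (simp add: blank_tape_def)
  from comput_app1[OF this comput_pair[OF comput_arg[of 0] comput_arg[of 1]]] show ?thesis by simp
qed

section \<open>The diagonal problem\<close>

text \<open>
  Machine \<open>z\<close> on input \<open>z\<close> has answered 0 by time \<open>t\<close>: it has halted, and the first output cell
  holds the terminator 2.
\<close>

definition halts0 :: "nat \<Rightarrow> nat \<Rightarrow> bool" where
  "halts0 z t \<longleftrightarrow> (let D = contents blank_tape (word_tape (encode [z])); c = sim D z t in
     entry D z c = 0 \<and> rd D (snd (prod_decode c)) (cellk 2 0) = 2)"

lemma decid_halts0: "decid (\<lambda>e. halts0 (arg 0 e) (arg 1 e))"
proof -
  have D: "comput (\<lambda>e. contents blank_tape (word_tape (encode [arg 0 e])) (arg 1 e))"
    unfolding contents_def blank_tape_def word_tape_encode_single by (rule comput_intros)+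
  show ?thesis
    unfolding halts0_def Let_def cellk_def
    by (rule comput_rd[OF D] comput_sim[OF D] comput_entry[OF D] comput_intros)+
qed

text \<open>Asking for the answer 0 instead of mere halting lets the supposed decider itself be the
  diagonal machine: run on its own code it always halts, and it answers 0 exactly if it does not
  answer 0.\<close>

lemma halts0_undecidable: "\<not> decid (\<lambda>e. \<exists>t. halts0 (arg 0 e) t)"
proof
  assume "decid (\<lambda>e. \<exists>t. halts0 (arg 0 e) t)"
  then have "recursive1 (\<lambda>z. of_bool (\<exists>t. halts0 z t))"
    unfolding decid_def by (rule comput_imp_recursive1)
  then obtain M where M: "is_tm M" "\<And>z. computes M blank_tape [z] [of_bool (\<exists>t. halts0 z t)]"
    unfolding recursive1_def by blast
  from tm_code_exists[OF M(1)] obtain z where z: "tm_code z M" by blast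
  define D where "D = contents blank_tape (word_tape (encode [z]))"
  define b where "b \<longleftrightarrow> (\<exists>t. halts0 z t)"
  from computes_sim[OF M(1) z M(2)[of z]] obtain k where
    k: "\<And>t. entry D z (sim D z t) = 0 \<longleftrightarrow> k \<le> t"
      "\<And>t j. k \<le> t \<Longrightarrow> rd D (snd (prod_decode (sim D z t))) (cellk 2 j) = word_tape (encode [of_bool b]) j"
    unfolding D_def b_def by metis
  have "halts0 z t \<longleftrightarrow> k \<le> t \<and> word_tape (encode [of_bool b]) 0 = 2" for t
    unfolding halts0_def Let_def D_def[symmetric] using k by auto
  moreover have "word_tape (encode [of_bool b]) 0 = 2 \<longleftrightarrow> \<not> b"
    by (cases b) (auto simp: word_tape_def encode_def)
  ultimately have "halts0 z t \<longleftrightarrow> k \<le> t \<and> \<not> b" for t by simp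
  then have "(\<exists>t. halts0 z t) \<longleftrightarrow> \<not> b" by auto
  then show False unfolding b_def by blast
qed

section \<open>Borel--Turing computable functions are Banach--Mazur computable\<close>

lemma concat_map_upt_blocks:
  assumes "w > 0"
  shows "concat (map (\<lambda>l. map (g l) [0..<w]) [0..<n]) = map (\<lambda>m. g (m div w) (m mod w)) [0..<n * w]"
proof (induction n)
  case (Suc n)
  have "map (\<lambda>m. g (m div w) (m mod w)) [n * w..<w + n * w] = map (g n) [0..<w]"
    using assms by (simp add: map_add_upt[symmetric])
  moreover have "[0..<Suc n * w] = [0..<n * w] @ [n * w..<w + n * w]"
    using upt_add_eq_append[of 0 "n * w" w] by (simp add: add.commute)
  ultimately show ?case using Suc by simp
qed simp

definition row_entry ::
  "('n::finite \<Rightarrow> nat \<Rightarrow> nat) \<Rightarrow> ('n \<Rightarrow> nat \<Rightarrow> nat) \<Rightarrow> ('n \<Rightarrow> nat \<Rightarrow> nat) \<Rightarrow> nat \<Rightarrow> nat \<Rightarrow> nat" where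
  "row_entry s p q k m = (if m mod 3 = 0 then s else if m mod 3 = 1 then p else q) (from_nat_into UNIV (m div 3)) k"

lemma row_eq:
  fixes s :: "'n::finite \<Rightarrow> nat \<Rightarrow> nat"
  shows "row s p q k = map (row_entry s p q k) [0..<CARD('n) * 3]"
proof -
  have "(let i = from_nat_into UNIV l in [s i k, p i k, q i k]) =
      map (\<lambda>j. (if j = 0 then s else if j = 1 then p else q) (from_nat_into UNIV l) k) [0..<3]" for l
    by (simp add: Let_def numeral_3_eq_3)
  then show ?thesis
    unfolding row_def row_entry_def by (simp only:) (rule concat_map_upt_blocks, simp)
qed

text \<open>A 2 stands exactly where a code ends, and the codes end at the partial sums of their
  lengths \<open>Suc (x i)\<close>. So cell \<open>j\<close> is found by a bounded quantifier,
  without locating the number it belongs to.\<close>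

lemma encode_nth:
  assumes "j < (\<Sum>i<n. Suc (x i))"
  shows "encode (map x [0..<n]) ! j = (if \<exists>m<n. (\<Sum>i<Suc m. Suc (x i)) = Suc j then 2 else 1)"
  using assms
proof (induction n)
  case (Suc n)
  define S where "S n = (\<Sum>i<n. Suc (x i))" for n
  have S_Suc: "S (Suc n) = S n + Suc (x n)" for n by (simp add: S_def)
  have mono: "S m \<le> S n" if "m \<le> n" for m n
    unfolding S_def using that by (intro sum_mono2) auto
  have len: "length (encode (map x [0..<n])) = S n" for n
    by (induction n) (simp_all add: S_def encode_def)
  have e: "encode (map x [0..<Suc n]) = encode (map x [0..<n]) @ replicate (x n) 1 @ [2]"
    by (simp add: encode_def)
  show ?case
  proof (cases "j < S n")
    case True
    then have "S (Suc n) \<noteq> Suc j" unfolding S_Suc by simp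
    then have "(\<exists>m<Suc n. S (Suc m) = Suc j) \<longleftrightarrow> (\<exists>m<n. S (Suc m) = Suc j)"
      by (metis less_Suc_eq)
    then show ?thesis using True Suc.IH unfolding e by (simp add: nth_append len S_def)
  next
    case False
    have "S (Suc m) \<noteq> Suc j" if "m < n" for m
      using mono[of "Suc m" n] that False by auto
    then have "(\<exists>m<Suc n. S (Suc m) = Suc j) \<longleftrightarrow> j = S n + x n"
      unfolding less_Suc_eq by (auto simp: S_Suc)
    moreover have "j < S n + Suc (x n)" using Suc.prems by (simp add: S_def)
    ultimately show ?thesis
      using False unfolding e by (auto simp: nth_append len S_def[symmetric] nth_Cons split: nat.split)
  qed
qed simp

lemma stream_tape_eq:
  assumes "\<And>k. u k = map (h k) [0..<w]" "w > 0"
  shows "stream_tape u j =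
    (if \<exists>m<Suc j * w. (\<Sum>i<Suc m. Suc (h (i div w) (i mod w))) = Suc j then 2 else 1)"
proof -
  have "concat (map (\<lambda>k. encode (u k)) ks) = encode (concat (map u ks))" for ks
    by (induction ks) (simp_all add: encode_append, simp add: encode_def)
  moreover have "concat (map u [0..<Suc j]) = map (\<lambda>m. h (m div w) (m mod w)) [0..<Suc j * w]"
    unfolding assms(1) using concat_map_upt_blocks[OF assms(2)] .
  \<comment> \<open>Each code occupies at least one cell, so the codes of \<open>Suc j * w\<close>
    numbers reach cell \<open>j\<close>.\<close>
  moreover have "j < (\<Sum>i<Suc j * w. Suc (h (i div w) (i mod w)))"
  proof -
    have "j < (\<Sum>i<Suc j * w. 1)" using assms(2) by (cases w) auto
    also have "\<dots> \<le> (\<Sum>i<Suc j * w. Suc (h (i div w) (i mod w)))" by (rule sum_mono) simp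
    finally show ?thesis .
  qed
  ultimately show ?thesis unfolding stream_tape_def by (simp only: encode_nth)
qed

text \<open>The components of a vector come with unrelated programs, one for each of finitely many
  indices; a case distinction merges them into one program that takes the index as an
  argument.\<close>

lemma comput_finite_cases:
  assumes "\<And>m. m < w \<Longrightarrow> comput (\<lambda>e. g m (arg 0 e) (arg 1 e))"
  shows "comput (\<lambda>e. if arg 2 e < w then g (arg 2 e) (arg 0 e) (arg 1 e) else 0)"
  using assms
proof (induction w)
  case 0
  then show ?case by (simp add: comput_zero)
next
  case (Suc w)
  have "(if m < Suc w then g m n k else 0) = (if m = w then g w n k else if m < w then g m n k else 0)"
    for m n k by auto
  then show ?case
    by (simp only:) (intro comput_if decid_eq comput_arg comput_const Suc.prems Suc.IH, simp_all)
qed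

lemma comput_stream_tape:
  fixes s p q :: "'n::finite \<Rightarrow> nat \<Rightarrow> nat \<Rightarrow> nat"
  assumes "\<And>i. recursive2 (s i)" "\<And>i. recursive2 (p i)" "\<And>i. recursive2 (q i)"
  shows "comput (\<lambda>e. stream_tape (row (\<lambda>i. s i (arg 0 e)) (\<lambda>i. p i (arg 0 e)) (\<lambda>i. q i (arg 0 e))) (arg 1 e))"
proof -
  let ?w = "CARD('n) * 3"
  define g where "g m n k = row_entry (\<lambda>i. s i n) (\<lambda>i. p i n) (\<lambda>i. q i n) k m" for m n k
  define h where "h n k m = (if m < ?w then g m n k else 0)" for m n k
  have "comput (\<lambda>e. g m (arg 0 e) (arg 1 e))" for m
    unfolding g_def row_entry_def
    using assms[THEN recursive2_imp_comput] by (cases "m mod 3 = 0"; cases "m mod 3 = 1") simp_all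
  then have h: "comput (\<lambda>e. h (arg 0 e) (arg 1 e) (arg 2 e))"
    unfolding h_def by (rule comput_finite_cases)
  have "row (\<lambda>i. s i n) (\<lambda>i. p i n) (\<lambda>i. q i n) k = map (h n k) [0..<?w]" for n k
    unfolding row_eq by (simp add: h_def g_def)
  then have "stream_tape (row (\<lambda>i. s i n) (\<lambda>i. p i n) (\<lambda>i. q i n)) j =
    (if \<exists>m<Suc j * ?w. (\<Sum>i<Suc m. Suc (h n (i div ?w) (i mod ?w))) = Suc j then 2 else 1)" for n j
    by (rule stream_tape_eq) simp
  then show ?thesis
    by (simp only:) (rule comput_app3[OF h] comput_intros | simp only: arg_tl)+
qed

lemma recursive2_slice: "recursive2 f \<Longrightarrow> recursive1 (f n)"
  by (rule comput_imp_recursive1, rule comput_app2[OF recursive2_imp_comput])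
    (simp_all add: comput_const comput_arg)

lemma computable_real_seqE:
  assumes "computable_real_seq x"
  obtains s p q where "recursive2 s" "recursive2 p" "recursive2 q" "\<And>n k. q n k \<noteq> 0"
    "\<And>n k. \<bar>of_rat ((-1) ^ s n k * (of_nat (p n k) / of_nat (q n k))) - x n\<bar> \<le> 1 / 2 ^ k"
    "\<And>n. \<exists>r. presents (s n) (p n) (q n) r \<and> representation r (x n)"
proof -
  from assms obtain r s p q where r: "recursive2 s" "recursive2 p" "recursive2 q" "\<And>n k. q n k \<noteq> 0"
    "\<And>n k. r n k = (-1) ^ s n k * (of_nat (p n k) / of_nat (q n k))"
    "\<And>n k. \<bar>of_rat (r n k) - x n\<bar> \<le> 1 / 2 ^ k"
    unfolding computable_real_seq_def computable_rat_double_seq_def by blast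
  have "presents (s n) (p n) (q n) (r n)" for n
    using r by (simp add: presents_def recursive2_slice)
  moreover from this have "representation (r n) (x n)" for n
    using r(6) unfolding representation_def computable_rat_seq_def converges_effectively_def by blast
  ultimately show thesis using r by (intro that[of s p q]) metis+
qed

lemma computable_real_seq_in_Rc: "computable_real_seq x \<Longrightarrow> x n \<in> Rc"
  unfolding Rc_def by (erule computable_real_seqE) blast

theorem borel_turing_imp_banach_mazur:
  fixes f :: "real ^ 'n \<Rightarrow> real ^ 'm"
  assumes "borel_turing_computable_on D f"
  shows "banach_mazur_computable_on D f"
  unfolding banach_mazur_computable_on_def
proof (intro allI impI, elim conjE)
  fix a :: "nat \<Rightarrow> real ^ 'n"
  assume aD: "\<forall>n. a n \<in> D" and a: "computable_vec_seq a"
  from assms obtain M where M: "is_tm M" "\<And>x s p q. x \<in> D \<Longrightarrow> vec_representation s p q x \<Longrightarrow>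
    \<exists>s' p' q'. vec_representation s' p' q' (f x) \<and>
      (\<forall>k. computes M (stream_tape (row s p q)) [k] (row s' p' q' k))"
    unfolding borel_turing_computable_on_def by blast
  have "\<forall>i. \<exists>s p q. recursive2 s \<and> recursive2 p \<and> recursive2 q \<and>
      (\<forall>n. \<exists>r. presents (s n) (p n) (q n) r \<and> representation r (a n $ i))"
    using a unfolding computable_vec_seq_def by (meson computable_real_seqE)
  then obtain s p q where spq: "\<And>i. recursive2 (s i)" "\<And>i. recursive2 (p i)" "\<And>i. recursive2 (q i)"
    "\<And>i n. \<exists>r. presents (s i n) (p i n) (q i n) r \<and> representation r (a n $ i)"
    by metis
  have "vec_representation (\<lambda>i. s i n) (\<lambda>i. p i n) (\<lambda>i. q i n) (a n)" for n
    unfolding vec_representation_def using spq(4) by blast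
  then have "\<forall>n. \<exists>s' p' q'. vec_representation s' p' q' (f (a n)) \<and>
      (\<forall>k. computes M (stream_tape (row (\<lambda>i. s i n) (\<lambda>i. p i n) (\<lambda>i. q i n))) [k] (row s' p' q' k))"
    using M(2) aD by blast
  \<comment> \<open>The representation of \<open>f (a n)\<close> is picked separately for each
    \<open>n\<close>. Uniformity in \<open>n\<close> comes from the machine, whose output determines
    these numbers.\<close>
  then obtain s' p' q' where out: "\<And>n. vec_representation (s' n) (p' n) (q' n) (f (a n))"
    "\<And>n k. computes M (stream_tape (row (\<lambda>i. s i n) (\<lambda>i. p i n) (\<lambda>i. q i n))) [k]
       (row (s' n) (p' n) (q' n) k)"
    by metis
  have "comput (\<lambda>e. arg l ((\<lambda>x. row (s' (fst (prod_decode x))) (p' (fst (prod_decode x)))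
      (q' (fst (prod_decode x))) (snd (prod_decode x))) (arg 0 e)))" for l
  proof (rule comput_computes[OF M(1)])
    show "computes M (stream_tape (row (\<lambda>i. s i (fst (prod_decode x))) (\<lambda>i. p i (fst (prod_decode x)))
        (\<lambda>i. q i (fst (prod_decode x))))) [snd (prod_decode x)]
        (row (s' (fst (prod_decode x))) (p' (fst (prod_decode x))) (q' (fst (prod_decode x)))
          (snd (prod_decode x)))" for x
      by (rule out)
    show "comput (\<lambda>e. stream_tape (row (\<lambda>i. s i (fst (prod_decode (arg 0 e))))
        (\<lambda>i. p i (fst (prod_decode (arg 0 e)))) (\<lambda>i. q i (fst (prod_decode (arg 0 e))))) (arg 1 e))"
      by (rule comput_app2[OF comput_stream_tape[OF spq(1-3)]]) (rule comput_intros)+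
    show "comput (\<lambda>e. word_tape (encode [snd (prod_decode (arg 0 e))]) (arg 1 e))"
      unfolding word_tape_encode_single by (rule comput_intros)+
  qed
  from comput_app1[OF this comput_pair[OF comput_arg[of 0] comput_arg[of 1]]]
  have "comput (\<lambda>e. arg l (row (s' (arg 0 e)) (p' (arg 0 e)) (q' (arg 0 e)) (arg 1 e)))" for l
    by simp
  then have rec: "recursive2 (\<lambda>n k. arg l (row (s' n) (p' n) (q' n) k))" for l
    by (rule comput_imp_recursive2)
  show "computable_vec_seq (\<lambda>n. f (a n))"
    unfolding computable_vec_seq_def
  proof
    fix i :: 'm
    \<comment> \<open>Component \<open>i\<close> occupies the entries \<open>l * 3\<close> to
      \<open>l * 3 + 2\<close> of a row, \<open>l\<close> being its position in the fixed
      enumeration of the index type.\<close>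
    obtain l where l: "l < CARD('m)" "from_nat_into UNIV l = i"
      using bij_betw_from_nat_into_finite[of "UNIV :: 'm set"]
      by (metis UNIV_I bij_betw_imp_surj_on finite imageE lessThan_iff)
    have entry: "arg m (row s p q k) = row_entry s p q k m" if "m < CARD('m) * 3"
      for m k and s p q :: "'m \<Rightarrow> nat \<Rightarrow> nat"
      using that by (simp add: arg_def row_eq)
    have "arg (l * 3) (row s p q k) = s i k \<and> arg (l * 3 + 1) (row s p q k) = p i k \<and>
        arg (l * 3 + 2) (row s p q k) = q i k" for k and s p q :: "'m \<Rightarrow> nat \<Rightarrow> nat"
    proof -
      have "(l * 3 + 1) mod 3 = 1" "(l * 3 + 2) mod 3 = 2" "(l * 3 + 1) div 3 = l" "(l * 3 + 2) div 3 = l"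
        by presburger+
      then show ?thesis using l by (simp add: entry row_entry_def)
    qed
    then have r: "recursive2 (\<lambda>n. s' n i)" "recursive2 (\<lambda>n. p' n i)" "recursive2 (\<lambda>n. q' n i)"
      using rec[of "l * 3"] rec[of "l * 3 + 1"] rec[of "l * 3 + 2"] by simp_all
    have "\<exists>r. presents (s' n i) (p' n i) (q' n i) r \<and> representation r (f (a n) $ i)" for n
      using out(1) by (simp add: vec_representation_def)
    then have "q' n i k \<noteq> 0 \<and> \<bar>of_rat ((-1) ^ s' n i k * (of_nat (p' n i k) / of_nat (q' n i k)))
        - f (a n) $ i\<bar> \<le> 1 / 2 ^ k" for n k
      unfolding presents_def representation_def converges_effectively_def by metis
    moreover from this r have "computable_rat_double_seq
        (\<lambda>n k. (-1) ^ s' n i k * (of_nat (p' n i k) / of_nat (q' n i k)))"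
      unfolding computable_rat_double_seq_def
      by (intro exI[of _ "\<lambda>n. s' n i"] exI[of _ "\<lambda>n. p' n i"] exI[of _ "\<lambda>n. q' n i"]) simp
    ultimately show "computable_real_seq (\<lambda>n. f (a n) $ i)"
      unfolding computable_real_seq_def by blast
  qed
qed

section \<open>A computable sequence that encodes the halting problem\<close>

lemma decid_app2:
  "decid (\<lambda>e. P (arg 0 e) (arg 1 e)) \<Longrightarrow> comput f \<Longrightarrow> comput g \<Longrightarrow> decid (\<lambda>e. P (f e) (g e))"
  unfolding decid_def by (rule comput_app2)

text \<open>The time of the answer may fail to exist, so \<open>comput_Least\<close> cannot search
  for it. Below a bound it is the only index that meets the condition.\<close>

lemma bounded_Least_sum:
  "(\<Sum>m<k. if P m \<and> \<not> (\<exists>i<m. P i) then m else 0) = (if \<exists>i<k. P i then LEAST m. P m else 0)"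
  for P :: "nat \<Rightarrow> bool"
proof (cases "\<exists>i<k. P i")
  case True
  let ?l = "LEAST m. P m"
  have l: "P ?l" "?l < k"
    using True by (auto intro: LeastI) (metis Least_le le_less_trans)
  have "P m \<and> \<not> (\<exists>i<m. P i) \<longleftrightarrow> m = ?l" for m
    using l(1) by (metis Least_equality not_less not_less_Least)
  then show ?thesis using True l(2) by simp
qed (auto intro: sum.neutral)

text \<open>An even \<sigma> selects the right side of \<open>t0\<close>, an odd one the left side.
  The sequence is computable although its case distinction is undecidable: up to precision
  \<open>1 / 2 ^ k\<close> the case matters only if the answer comes by time
  \<open>k\<close>.\<close>

lemma halting_sequence:
  assumes "t0 \<in> Rc"
  shows "\<exists>t. computable_real_seq t \<and> (\<forall>n. if \<exists>m. halts0 n m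
     then 0 < (-1) ^ \<sigma> * (t n - t0) \<and> (-1) ^ \<sigma> * (t n - t0) \<le> 1 / 2 ^ m0 else t n = t0)"
proof -
  from assms obtain r0 s p q where r0: "recursive1 s" "recursive1 p" "recursive1 q" "\<And>k. q k \<noteq> 0"
    "\<And>k. r0 k = (-1) ^ s k * (of_nat (p k) / of_nat (q k))" "\<And>k. \<bar>of_rat (r0 k) - t0\<bar> \<le> 1 / 2 ^ k"
    unfolding Rc_def representation_def computable_rat_seq_def presents_def converges_effectively_def
    by blast
  note c = comput_app1[OF recursive1_imp_comput[OF r0(1)]] comput_app1[OF recursive1_imp_comput[OF r0(2)]]
    comput_app1[OF recursive1_imp_comput[OF r0(3)]]
  \<comment> \<open>\<open>U m\<close> is \<open>r0 (m + 2)\<close> moved by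
    \<open>1 / 2 ^ (m + 1)\<close> to the chosen side. The error of \<open>r0 (m + 2)\<close> is at
    most half of this shift, so \<open>U m\<close> lies strictly on that side, at distance at most
    \<open>3 / 2 ^ (m + 2)\<close>. \<open>P m\<close> and \<open>uq m\<close> bring both terms to a
    common denominator.\<close>
  define P where "P m = p (m + 2) * 2 ^ (m + 1)" for m
  \<comment> \<open>Sign and absolute value of a sum of two signed naturals: equal signs add;
    otherwise the smaller number is subtracted from the larger, whose sign is kept.\<close>
  define us where "us m = (if even (s (m + 2) + \<sigma>) \<or> q (m + 2) \<le> P m then s (m + 2) else \<sigma>)" for m
  define up where "up m = (if even (s (m + 2) + \<sigma>) then P m + q (m + 2)
    else if q (m + 2) \<le> P m then P m - q (m + 2) else q (m + 2) - P m)" for m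
  define uq where "uq m = q (m + 2) * 2 ^ (m + 1)" for m
  define U :: "nat \<Rightarrow> rat" where "U m = (-1) ^ us m * (of_nat (up m) / of_nat (uq m))" for m
  have U_eq: "U m = r0 (m + 2) + (-1) ^ \<sigma> / 2 ^ (m + 1)" for m
  proof -
    have "(-1) ^ us m * (of_nat (up m) :: rat) =
        (-1) ^ s (m + 2) * of_nat (P m) + (-1) ^ \<sigma> * of_nat (q (m + 2))"
      unfolding us_def up_def by (cases "even (s (m + 2))"; cases "even \<sigma>") (auto simp: of_nat_diff)
    then have "U m = ((-1) ^ s (m + 2) * of_nat (P m) + (-1) ^ \<sigma> * of_nat (q (m + 2))) / of_nat (uq m)"
      unfolding U_def by simp
    also have "\<dots> = r0 (m + 2) + (-1) ^ \<sigma> / 2 ^ (m + 1)"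
      using r0(4)[of "m + 2"] by (simp add: r0(5) P_def uq_def field_simps)
    finally show ?thesis .
  qed
  have sq: "(-1 :: real) ^ \<sigma> * (-1) ^ \<sigma> = 1" by (simp flip: power_mult_distrib)
  have U_bound: "0 < (-1) ^ \<sigma> * (of_rat (U m) - t0)" "(-1) ^ \<sigma> * (of_rat (U m) - t0) \<le> 1 / 2 ^ m" for m
  proof -
    define d where "d = (-1) ^ \<sigma> * (of_rat (r0 (m + 2)) - t0)"
    have "\<bar>d\<bar> \<le> 1 / 2 ^ (m + 2)" using r0(6)[of "m + 2"] by (simp add: d_def abs_mult power_abs)
    moreover have "of_rat (U m) = of_rat (r0 (m + 2)) + (-1 :: real) ^ \<sigma> / 2 ^ (m + 1)"
      unfolding U_eq by (simp add: of_rat_add of_rat_mult of_rat_divide of_rat_power of_rat_minus)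
    then have "(-1) ^ \<sigma> * (of_rat (U m) - t0) = d + 1 / 2 ^ (m + 1)"
      using sq by (simp add: d_def algebra_simps)
    moreover have "(1 :: real) / 2 ^ (m + 1) = 2 * (1 / 2 ^ (m + 2))" "(1 :: real) / 2 ^ m = 4 * (1 / 2 ^ (m + 2))"
      "(0 :: real) < 1 / 2 ^ (m + 2)" by simp_all
    ultimately show "0 < (-1) ^ \<sigma> * (of_rat (U m) - t0)" "(-1) ^ \<sigma> * (of_rat (U m) - t0) \<le> 1 / 2 ^ m"
      by linarith+
  qed
  define hit where "hit n k \<longleftrightarrow> (\<exists>i<Suc k. halts0 n i)" for n k
  define first where "first n k = (\<Sum>m<Suc k. if halts0 n m \<and> \<not> (\<exists>i<m. halts0 n i) then m else 0)" for n k
  have first_eq: "first n k = (LEAST m. halts0 n m)" if "hit n k" for n k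
    using that unfolding first_def bounded_Least_sum hit_def by simp
  have halts: "decid (\<lambda>e. halts0 (f e) (g e))" if "comput f" "comput g" for f g
    by (rule decid_app2[OF decid_halts0 that])
  have hit: "decid (\<lambda>e. hit (f e) (g e))" if "comput f" "comput g" for f g
    by (rule decid_app2[OF _ that], unfold hit_def)
      (rule comput_intros halts | simp only: arg_tl)+
  have first: "comput (\<lambda>e. first (f e) (g e))" if "comput f" "comput g" for f g
    by (rule comput_app2[OF _ that], unfold first_def)
      (rule comput_intros halts | simp only: arg_tl)+
  \<comment> \<open>On a hit by time \<open>k\<close> the approximation is exact. On a miss
    \<open>r0 (Suc k)\<close> has error at most \<open>1 / 2 ^ Suc k\<close>, and a later hit, at
    time \<open>Suc k\<close> or after, moves \<open>t n\<close> away from \<open>t0\<close> by at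
    most as much again.\<close>
  define S where "S n k = (if hit n k then us (m0 + first n k) else s (Suc k))" for n k
  define N where "N n k = (if hit n k then up (m0 + first n k) else p (Suc k))" for n k
  define Q where "Q n k = (if hit n k then uq (m0 + first n k) else q (Suc k))" for n k
  define R :: "nat \<Rightarrow> nat \<Rightarrow> rat" where "R n k = (-1) ^ S n k * (of_nat (N n k) / of_nat (Q n k))" for n k
  have "recursive2 S" "recursive2 N" "recursive2 Q"
    unfolding S_def N_def Q_def us_def up_def uq_def P_def
    by (rule comput_imp_recursive2 c hit first comput_intros)+
  moreover have "Q n k \<noteq> 0" for n k using r0(4) by (simp add: Q_def uq_def)
  ultimately have R: "computable_rat_double_seq R"
    unfolding computable_rat_double_seq_def R_def by blast
  define t where "t n = (if \<exists>m. halts0 n m then of_rat (U (m0 + (LEAST m. halts0 n m))) else t0)" for n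
  have "\<bar>of_rat (R n k) - t n\<bar> \<le> 1 / 2 ^ k" for n k
  proof (cases "hit n k")
    case True
    then have "R n k = U (m0 + (LEAST m. halts0 n m))"
      by (simp add: R_def S_def N_def Q_def U_def first_eq)
    moreover have "\<exists>m. halts0 n m" using True by (auto simp: hit_def)
    ultimately show ?thesis by (simp add: t_def)
  next
    case False
    then have "R n k = r0 (Suc k)" by (simp add: R_def S_def N_def Q_def r0(5))
    then have R: "\<bar>of_rat (R n k) - t0\<bar> \<le> 1 / 2 ^ Suc k" using r0(6)[of "Suc k"] by simp
    have "\<bar>t n - t0\<bar> \<le> 1 / 2 ^ Suc k"
    proof (cases "\<exists>m. halts0 n m")
      case True
      let ?m = "LEAST m. halts0 n m"
      have "halts0 n ?m" using True by (rule LeastI_ex)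
      then have "\<not> ?m < Suc k" using False unfolding hit_def by blast
      then have "Suc k \<le> m0 + ?m" by linarith
      then have "(1 :: real) / 2 ^ (m0 + ?m) \<le> 1 / 2 ^ Suc k"
        by (intro divide_left_mono power_increasing) auto
      moreover have "\<bar>of_rat (U (m0 + ?m)) - t0\<bar> = \<bar>(-1) ^ \<sigma> * (of_rat (U (m0 + ?m)) - t0)\<bar>"
        by (simp add: abs_mult power_abs)
      ultimately show ?thesis
        using True U_bound[of "m0 + ?m"] by (simp add: t_def)
    qed (simp add: t_def)
    with R have "\<bar>of_rat (R n k) - t n\<bar> \<le> 2 * (1 / 2 ^ Suc k)" by linarith
    then show ?thesis by simp
  qed
  with R have "computable_real_seq t" unfolding computable_real_seq_def by blast
  moreover have "(-1) ^ \<sigma> * (of_rat (U (m0 + m)) - t0) \<le> 1 / 2 ^ m0" for m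
  proof -
    have "(1 :: real) / 2 ^ (m0 + m) \<le> 1 / 2 ^ m0" by (intro divide_left_mono power_increasing) auto
    then show ?thesis using U_bound(2)[of "m0 + m"] by linarith
  qed
  ultimately show ?thesis using U_bound(1) by (intro exI[of _ t]) (auto simp: t_def)
qed

section \<open>Separating the values of a computable sequence\<close>

text \<open>Cross-multiplication, with every negative term moved to the other side so that only
  natural numbers are compared.\<close>

lemma decid_rat_less:
  assumes "comput s" "comput p" "comput q" "\<And>e. q e \<noteq> 0"
  shows "decid (\<lambda>e. (-1) ^ s e * (of_nat (p e) / of_nat (q e)) < (c :: rat))"
proof -
  obtain a d :: int where c: "c = of_int a / of_int d" "d > 0"
    by (cases c) (auto simp: Fract_of_int_quotient)
  define A B D where "A = nat a" and "B = nat (- a)" and "D = nat d"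
  have cd: "c = (of_nat A - of_nat B) / of_nat D" and D: "D > 0"
    using c by (auto simp: A_def B_def D_def)
  have "(-1) ^ s e * (of_nat (p e) / of_nat (q e)) < c \<longleftrightarrow>
      (if even (s e) then p e * D else 0) + B * q e < A * q e + (if even (s e) then 0 else p e * D)" for e
  proof -
    have q: "(0 :: rat) < of_nat (q e)" "(0 :: rat) < of_nat D" using assms(4)[of e] D by auto
    define v :: rat where "v = (-1) ^ s e * of_nat (p e)"
    have "(-1) ^ s e * (of_nat (p e) / of_nat (q e)) < c \<longleftrightarrow> v / of_nat (q e) < (of_nat A - of_nat B) / of_nat D"
      by (simp add: v_def cd)
    also have "\<dots> \<longleftrightarrow> v * of_nat D < (of_nat A - of_nat B) * of_nat (q e)"
      using q by (simp add: field_simps)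
    also have "\<dots> \<longleftrightarrow> v * of_nat D + of_nat (B * q e) < of_nat (A * q e)"
      by (simp add: algebra_simps)
    also have "\<dots> \<longleftrightarrow> of_nat ((if even (s e) then p e * D else 0) + B * q e) <
        (of_nat (A * q e + (if even (s e) then 0 else p e * D)) :: rat)"
      by (simp add: v_def diff_less_eq)
    finally show ?thesis by (simp only: of_nat_less_iff)
  qed
  then show ?thesis by (simp only:) (intro assms comput_intros)
qed

text \<open>One approximation of fixed precision settles both cases, and in the gap between them
  \<open>T\<close> may take either value. Only two rational thresholds enter the test, so
  \<open>c\<close> may be any real number.\<close>

lemma decid_separated:
  assumes x: "computable_real_seq x" and "\<eta> > 0"
  shows "\<exists>T. decid (\<lambda>e. T (arg 0 e)) \<and> (\<forall>n. (x n = c \<longrightarrow> T n) \<and> (\<bar>x n - c\<bar> \<ge> \<eta> \<longrightarrow> \<not> T n))"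
proof -
  from computable_real_seqE[OF x] obtain s p q where spq: "recursive2 s" "recursive2 p" "recursive2 q"
    "\<And>n k. q n k \<noteq> 0"
    "\<And>n k. \<bar>of_rat ((-1) ^ s n k * (of_nat (p n k) / of_nat (q n k))) - x n\<bar> \<le> 1 / 2 ^ k"
    by metis
  define r :: "nat \<Rightarrow> nat \<Rightarrow> rat" where "r n k = (-1) ^ s n k * (of_nat (p n k) / of_nat (q n k))" for n k
  obtain k where k: "(1 / 2) ^ k < \<eta> / 4" using real_arch_pow_inv[of "\<eta> / 4" "1 / 2"] assms(2) by auto
  then have k: "1 / 2 ^ k < \<eta> / 4" by (simp add: power_divide)
  \<comment> \<open>The approximation errs by less than \<open>\<eta> / 4\<close>. If
    \<open>x n = c\<close>, it is closer to \<open>c\<close> than \<open>\<eta> / 4\<close> and lies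
    between the thresholds; if \<open>x n\<close> is at least \<eta> away, it is further than
    \<open>3 * \<eta> / 4\<close> and lies outside.\<close>
  obtain lo where lo: "c - \<eta> / 2 < of_rat lo" "of_rat lo < c - \<eta> / 4"
    using of_rat_dense[of "c - \<eta> / 2" "c - \<eta> / 4"] assms(2) by auto
  obtain hi where hi: "c + \<eta> / 4 < of_rat hi" "of_rat hi < c + \<eta> / 2"
    using of_rat_dense[of "c + \<eta> / 4" "c + \<eta> / 2"] assms(2) by auto
  \<comment> \<open>The extra sign from \<open>Suc\<close> turns the lower bound into an upper
    bound, so \<open>decid_rat_less\<close> serves for both.\<close>
  define T where "T n \<longleftrightarrow> (-1) ^ s n k * (of_nat (p n k) / of_nat (q n k)) < hi \<and>
    (-1) ^ Suc (s n k) * (of_nat (p n k) / of_nat (q n k)) < - lo" for n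
  have T: "T n \<longleftrightarrow> lo < r n k \<and> r n k < hi" for n by (auto simp: T_def r_def)
  have comp: "comput (\<lambda>e. f (arg 0 e) k)" if "recursive2 f" for f
    by (rule comput_app2[OF recursive2_imp_comput[OF that]]) (rule comput_intros)+
  have "decid (\<lambda>e. T (arg 0 e))"
    unfolding T_def using spq by (intro decid_conj decid_rat_less comp comput_Suc) auto
  moreover have "\<bar>of_rat (r n k) - x n\<bar> < \<eta> / 4" for n
    using spq(5)[of n k] k by (simp add: r_def)
  moreover have "T n \<longleftrightarrow> (of_rat lo :: real) < of_rat (r n k) \<and> (of_rat (r n k) :: real) < of_rat hi" for n
    by (simp add: T of_rat_less)
  ultimately show ?thesis using lo hi
    by (intro exI[of _ T] conjI allI impI) (smt (verit) field_sum_of_halves)+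
qed

lemma decid_ball_finite:
  "finite A \<Longrightarrow> (\<And>i. i \<in> A \<Longrightarrow> decid (P i)) \<Longrightarrow> decid (\<lambda>e. \<forall>i\<in>A. P i e)"
proof (induction rule: finite_induct)
  case empty
  then show ?case by (simp add: decid_def comput_const)
qed (simp add: decid_conj)

text \<open>Equality becomes decidable because \<open>c\<close> is isolated among the values: a
  coordinate test is ambiguous only in its gap, and if \<open>b n \<noteq> c\<close>, some
  coordinate lies beyond the gap.\<close>

lemma decid_eq_isolated:
  fixes b :: "nat \<Rightarrow> real ^ 'n"
  assumes "computable_vec_seq b" "\<eta> > 0" and sep: "\<And>n. b n = c \<or> (\<exists>i. \<bar>b n $ i - c $ i\<bar> \<ge> \<eta>)"
  shows "decid (\<lambda>e. b (arg 0 e) = c)"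
proof -
  have "\<forall>i. \<exists>T. decid (\<lambda>e. T (arg 0 e)) \<and>
      (\<forall>n. (b n $ i = c $ i \<longrightarrow> T n) \<and> (\<bar>b n $ i - c $ i\<bar> \<ge> \<eta> \<longrightarrow> \<not> T n))"
    using decid_separated[OF _ assms(2)] assms(1) unfolding computable_vec_seq_def by blast
  then obtain T where T: "\<And>i. decid (\<lambda>e. T i (arg 0 e))"
    "\<And>i n. b n $ i = c $ i \<Longrightarrow> T i n" "\<And>i n. \<bar>b n $ i - c $ i\<bar> \<ge> \<eta> \<Longrightarrow> \<not> T i n"
    by metis
  have "b n = c \<longleftrightarrow> (\<forall>i\<in>UNIV. T i n)" for n
  proof
    assume "\<forall>i\<in>UNIV. T i n"
    then have "\<not> \<bar>b n $ i - c $ i\<bar> \<ge> \<eta>" for i using T(3)[of n i] by blast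
    then show "b n = c" using sep[of n] by blast
  qed (use T(2) in blast)
  then show ?thesis by (simp only:) (intro decid_ball_finite T finite)
qed

text \<open>\<open>N x\<close> is at most the largest absolute coordinate times the sum of the norms
  of the unit vectors, so a large norm forces a large coordinate.\<close>

lemma is_norm_bound:
  fixes N :: "real ^ 'n \<Rightarrow> real"
  assumes N: "is_norm N" and "\<epsilon> > 0"
  shows "\<exists>\<eta>>0. \<forall>x. N x \<ge> \<epsilon> \<longrightarrow> (\<exists>i. \<bar>x $ i\<bar> \<ge> \<eta>)"
proof -
  have sum: "N (\<Sum>i\<in>A. f i) \<le> (\<Sum>i\<in>A. N (f i))" if "finite A" for A :: "'n set" and f
    using that
  proof induction
    case empty
    have "N 0 = 0" using N by (simp add: is_norm_def)
    then show ?case by simp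
  next
    case (insert i A)
    have "N (f i + (\<Sum>i\<in>A. f i)) \<le> N (f i) + N (\<Sum>i\<in>A. f i)" using N by (simp add: is_norm_def)
    with insert show ?case by simp
  qed
  \<comment> \<open>The summand 1 makes \<open>B\<close> positive and the final estimate
    strict.\<close>
  define B where "B = 1 + (\<Sum>i\<in>UNIV. N (axis i (1 :: real) :: real ^ 'n))"
  have B: "B > 0" using N unfolding B_def is_norm_def by (intro add_pos_nonneg sum_nonneg) auto
  have "\<exists>i. \<bar>x $ i\<bar> \<ge> \<epsilon> / B" if "N x \<ge> \<epsilon>" for x
  proof (rule ccontr)
    assume "\<nexists>i. \<epsilon> / B \<le> \<bar>x $ i\<bar>"
    then have small: "\<bar>x $ i\<bar> \<le> \<epsilon> / B" for i by (meson less_imp_le not_le)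
    have "N x = N (\<Sum>i\<in>UNIV. (x $ i) *\<^sub>R axis i 1)"
      using basis_expansion[of x] by (simp add: scalar_mult_eq_scaleR)
    also have "\<dots> \<le> (\<Sum>i\<in>UNIV. N ((x $ i) *\<^sub>R axis i 1))" by (rule sum) simp
    also have "\<dots> = (\<Sum>i\<in>UNIV. \<bar>x $ i\<bar> * N (axis i 1))" using N by (simp add: is_norm_def)
    also have "\<dots> \<le> (\<Sum>i\<in>UNIV. \<epsilon> / B * N (axis i (1 :: real) :: real ^ 'n))"
      using small N by (intro sum_mono mult_right_mono) (auto simp: is_norm_def)
    also have "\<dots> = \<epsilon> / B * (B - 1)" by (simp add: B_def sum_distrib_left)
    also have "\<dots> < \<epsilon>" using B assms(2) by (simp add: field_simps)
    finally show False using that by simp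
  qed
  then show ?thesis using B assms(2) by (intro exI[of _ "\<epsilon> / B"]) auto
qed

lemma no_computable_jump:
  fixes f :: "real \<Rightarrow> real ^ 'n" and N :: "real ^ 'n \<Rightarrow> real"
  assumes N: "is_norm N" and t0: "t0 \<in> {-1<..<1} \<inter> Rc" and "\<epsilon> > 0"
    and jump: "\<And>t t'. t \<in> {-1..<t0} \<inter> Rc \<Longrightarrow> t' \<in> {t0<..1} \<inter> Rc \<Longrightarrow> N (f t - f t') \<ge> 2 * \<epsilon>"
    and comp: "\<And>t. (\<And>n. t n \<in> {-1..1} \<inter> Rc) \<Longrightarrow> computable_real_seq t \<Longrightarrow>
      computable_vec_seq (\<lambda>n. f (t n))"
  shows False
proof -
  \<comment> \<open>If both sides failed, the cases 0 and 1 of \<sigma> would give points right and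
    left of \<open>t0\<close> whose values are both closer than \<epsilon> to \<open>f t0\<close>,
    hence closer than \<open>2 * \<epsilon>\<close> to each other.\<close>
  have "\<exists>\<sigma>::nat. \<forall>t\<in>{-1..1} \<inter> Rc. 0 < (-1) ^ \<sigma> * (t - t0) \<longrightarrow> N (f t - f t0) \<ge> \<epsilon>"
  proof (rule ccontr)
    assume no: "\<nexists>\<sigma>::nat. \<forall>t\<in>{-1..1} \<inter> Rc. 0 < (-1) ^ \<sigma> * (t - t0) \<longrightarrow> N (f t - f t0) \<ge> \<epsilon>"
    from no[unfolded not_ex, rule_format, of 0] obtain t' where
      t': "t' \<in> {-1..1} \<inter> Rc" "t0 < t'" "N (f t' - f t0) < \<epsilon>" by auto
    from no[unfolded not_ex, rule_format, of 1] obtain t where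
      t: "t \<in> {-1..1} \<inter> Rc" "t < t0" "N (f t - f t0) < \<epsilon>" by auto
    have "N (f t - f t') \<ge> 2 * \<epsilon>" using jump t t' by auto
    moreover have "N (f t0 - f t') = N (f t' - f t0)"
      using N unfolding is_norm_def by (metis abs_minus_cancel abs_one minus_diff_eq mult_1 scaleR_minus1_left)
    moreover have "N ((f t - f t0) + (f t0 - f t')) \<le> N (f t - f t0) + N (f t0 - f t')"
      using N unfolding is_norm_def by blast
    ultimately show False using t(3) t'(3) by simp
  qed
  then obtain \<sigma> :: nat where
    \<sigma>: "\<And>t. t \<in> {-1..1} \<inter> Rc \<Longrightarrow> 0 < (-1) ^ \<sigma> * (t - t0) \<Longrightarrow> N (f t - f t0) \<ge> \<epsilon>" by blast
  \<comment> \<open>Keeps the whole sequence within the interval on which \<open>comp\<close>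
    applies.\<close>
  obtain m0 where "(1 / 2) ^ m0 < min (1 - t0) (1 + t0)"
    using real_arch_pow_inv[of "min (1 - t0) (1 + t0)" "1 / 2"] t0 by auto
  then have m0: "1 / 2 ^ m0 < min (1 - t0) (1 + t0)" by (simp add: power_divide)
  obtain t where t: "computable_real_seq t" "\<And>n. if \<exists>m. halts0 n m
     then 0 < (-1) ^ \<sigma> * (t n - t0) \<and> (-1) ^ \<sigma> * (t n - t0) \<le> 1 / 2 ^ m0 else t n = t0"
    using halting_sequence[of t0 \<sigma> m0] t0 by auto
  have dom: "t n \<in> {-1..1} \<inter> Rc" for n
  proof -
    have "\<bar>t n - t0\<bar> = \<bar>(-1) ^ \<sigma> * (t n - t0)\<bar>" by (simp add: abs_mult power_abs)
    then have "\<bar>t n - t0\<bar> \<le> 1 / 2 ^ m0" using t(2)[of n] by (auto split: if_splits)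
    then show ?thesis using m0 computable_real_seq_in_Rc[OF t(1), of n] by auto
  qed
  obtain \<eta> where \<eta>: "\<eta> > 0" "\<And>x. N x \<ge> \<epsilon> \<Longrightarrow> \<exists>i. \<bar>x $ i\<bar> \<ge> \<eta>"
    using is_norm_bound[OF N \<open>\<epsilon> > 0\<close>] by blast
  have far: "N (f (t n) - f t0) \<ge> \<epsilon>" if "\<exists>m. halts0 n m" for n
    using \<sigma>[OF dom] t(2)[of n] that by auto
  have near: "f (t n) = f t0" if "\<nexists>m. halts0 n m" for n
    using t(2)[of n] that by auto
  have "decid (\<lambda>e. f (t (arg 0 e)) = f t0)"
  proof (rule decid_eq_isolated[OF comp[OF dom t(1)] \<eta>(1)])
    show "f (t n) = f t0 \<or> (\<exists>i. \<bar>f (t n) $ i - f t0 $ i\<bar> \<ge> \<eta>)" for n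
      using near[of n] \<eta>(2)[OF far[of n]] by fastforce
  qed
  moreover have "N 0 = 0" using N by (simp add: is_norm_def)
  then have "f (t n) = f t0 \<longleftrightarrow> \<not> (\<exists>m. halts0 n m)" for n
  proof (cases "\<exists>m. halts0 n m")
    case True
    then have "N (f (t n) - f t0) > 0" using far[of n, OF True] \<open>\<epsilon> > 0\<close> by linarith
    then have "f (t n) \<noteq> f t0" using \<open>N 0 = 0\<close> by auto
    with True show ?thesis by blast
  qed (use near in blast)
  ultimately have "decid (\<lambda>e. \<not> (\<exists>m. halts0 (arg 0 e) m))" by simp
  from decid_not[OF this] show False using halts0_undecidable by simp
qed

theorem theorem1:
  fixes X :: "(real ^ 'n) set" and Y :: "(real ^ 'm) set"
    and Xc :: "real ^ 'm \<Rightarrow> (real ^ 'n) set"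
    and F :: "real ^ 'n \<Rightarrow> real ^ 'm \<Rightarrow> real"
    and G :: "real ^ 'm \<Rightarrow> real ^ 'n"
    and Y1 Y2 :: "(real ^ 'm) set"
    and y1s y2s ys :: "real ^ 'm"
    and \<gamma> :: "real \<Rightarrow> real ^ 'm"
    and t0 \<kappa> :: real
    and normX :: "real ^ 'n \<Rightarrow> real" and normY :: "real ^ 'm \<Rightarrow> real"
  assumes "is_norm normX" and "is_norm normY"
    and "X \<subseteq> Rc_vec" and "Y \<subseteq> Rc_vec"
    and "\<forall>y\<in>Y. Xc y \<subseteq> X"
    and "\<forall>x\<in>X. \<forall>y\<in>Y. F x y \<in> Rc"
    and "continuous_on (X \<times> Y) (\<lambda>(x, y). F x y)"
    and "G \<in> Y \<rightarrow> X" and "\<forall>y\<in>Y. G y \<in> Opt F Xc y"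
    and "Y1 \<subseteq> Y" and "Y2 \<subseteq> Y" and "y1s \<in> Y1" and "y2s \<in> Y2" and "ys \<in> Y"
    and "\<gamma> \<in> {-1..1} \<inter> Rc \<rightarrow> Y"
    and "continuous_on ({-1..1} \<inter> Rc) \<gamma>"
    and "borel_turing_computable_on {v :: real ^ 1. v $ 1 \<in> {-1..1} \<inter> Rc} (\<lambda>v. \<gamma> (v $ 1))"
    and i: "Y1 \<inter> Y2 = {}" "G ` Y1 \<inter> G ` Y2 = {}"
    and ii: "(INF (y1, y2)\<in>Y1 \<times> Y2. normY (y1 - y2)) = 0"
    and iii: "(INF (y1, y2)\<in>Y1 \<times> Y2. normX (G y1 - G y2)) = \<kappa>" "\<kappa> > 0"
    and iv: "\<gamma> (-1) = y1s" "\<gamma> 1 = y2s" "t0 \<in> {-1<..<1} \<inter> Rc" "\<gamma> t0 = ys"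
    and v: "\<gamma> ` ({-1..<t0} \<inter> Rc) \<subseteq> Y1" "\<gamma> ` ({t0<..1} \<inter> Rc) \<subseteq> Y2"
  shows
    "(decidable_within (G ` Y1) (G ` Y1 \<union> G ` Y2) \<longrightarrow>
        \<not> borel_turing_computable_on Y G \<and>
        (\<forall>\<alpha>::real. \<alpha> < \<kappa> / 2 \<longrightarrow>
           \<not> (\<exists>H. H \<in> Y \<rightarrow> X \<and> borel_turing_computable_on Y H \<and>
                  sup_dist normX Y G H \<le> ereal \<alpha>))) \<and>
     (decidable_within Y1 (Y1 \<union> Y2) \<longrightarrow>
        \<not> banach_mazur_computable_on Y G \<and>
        (\<forall>\<alpha>::real. \<alpha> < \<kappa> / 2 \<longrightarrow>
           \<not> (\<exists>H. H \<in> Y \<rightarrow> X \<and> banach_mazur_computable_on Y H \<and>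
                  sup_dist normX Y G H \<le> ereal \<alpha>)))"
proof -
  let ?I = "{v :: real ^ 1. v $ 1 \<in> {-1..1} \<inter> Rc}"
  note N = \<open>is_norm normX\<close>[unfolded is_norm_def]
  have tri: "normX (x + y) \<le> normX x + normX y" for x y using N by blast
  have minus: "normX (x - y) = normX (y - x)" for x y
    using N by (metis abs_minus_cancel abs_one minus_diff_eq mult_1 scaleR_minus1_left)
  have gap: "normX (G y1 - G y2) \<ge> \<kappa>" if "y1 \<in> Y1" "y2 \<in> Y2" for y1 y2
  proof -
    have "bdd_below ((\<lambda>(y1, y2). normX (G y1 - G y2)) ` (Y1 \<times> Y2))"
      using N by (intro bdd_belowI[of _ 0]) auto
    from cINF_lower[OF this, of "(y1, y2)"] show ?thesis using that iii(1) by simp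
  qed
  have \<gamma>: "banach_mazur_computable_on ?I (\<lambda>v. \<gamma> (v $ 1))"
    by (rule borel_turing_imp_banach_mazur) fact
  \<comment> \<open>All four claims reduce to this one: \<open>G\<close> approximates itself with
    \<alpha> = 0, and Borel-Turing computability implies Banach-Mazur computability.\<close>
  have approx: False
    if H: "banach_mazur_computable_on Y H" and "\<alpha> < \<kappa> / 2" and dist: "sup_dist normX Y G H \<le> ereal \<alpha>"
    for H \<alpha>
  \<comment> \<open>Values of \<open>G\<close> across \<open>t0\<close> differ by at least \<kappa>,
    and passing to \<open>H\<close> costs at most \<alpha> on each side. Half of the remaining
    \<open>\<kappa> - 2 * \<alpha>\<close> plays the role of \<epsilon>.\<close>
  proof (rule no_computable_jump[OF \<open>is_norm normX\<close> iv(3), of "(\<kappa> - 2 * \<alpha>) / 2" "\<lambda>t. H (\<gamma> t)"])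
    show "(\<kappa> - 2 * \<alpha>) / 2 > 0" using that(2) by simp
    have close: "normX (G y - H y) \<le> \<alpha>" if "y \<in> Y" for y
      using dist that unfolding sup_dist_def SUP_le_iff by simp
    fix t t' assume "t \<in> {-1..<t0} \<inter> Rc" "t' \<in> {t0<..1} \<inter> Rc"
    then have y: "\<gamma> t \<in> Y1" "\<gamma> t' \<in> Y2" using v by auto
    let ?g = "G (\<gamma> t)" and ?g' = "G (\<gamma> t')" and ?h = "H (\<gamma> t)" and ?h' = "H (\<gamma> t')"
    have "normX (?g - ?g') \<le> normX (?g - ?h) + normX (?h - ?h') + normX (?h' - ?g')"
      using tri[of "?g - ?h" "?h - ?g'"] tri[of "?h - ?h'" "?h' - ?g'"] by simp
    moreover have "normX (?g - ?h) \<le> \<alpha>" "normX (?h' - ?g') \<le> \<alpha>"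
      using close y \<open>Y1 \<subseteq> Y\<close> \<open>Y2 \<subseteq> Y\<close> minus[of ?h'] by auto
    ultimately show "2 * ((\<kappa> - 2 * \<alpha>) / 2) \<le> normX (?h - ?h')"
      using gap[OF y] by simp
  next
    fix t assume t: "\<And>n. t n \<in> {-1..1} \<inter> Rc" "computable_real_seq t"
    \<comment> \<open>Computability of \<gamma> is stated on \<open>real ^ 1\<close>, so the reals
      \<open>t n\<close> are wrapped as vectors of length 1.\<close>
    define a :: "nat \<Rightarrow> real ^ 1" where "a n = vec (t n)" for n
    have "a n \<in> ?I" "computable_vec_seq a" for n
      using t by (simp_all add: a_def computable_vec_seq_def)
    then have "computable_vec_seq (\<lambda>n. \<gamma> (a n $ 1))"
      using \<gamma> unfolding banach_mazur_computable_on_def by blast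
    then have "computable_vec_seq (\<lambda>n. \<gamma> (t n))" by (simp add: a_def)
    moreover have "\<gamma> (t n) \<in> Y" for n using t(1) \<open>\<gamma> \<in> _\<close> by blast
    ultimately show "computable_vec_seq (\<lambda>n. H (\<gamma> (t n)))"
      using H[unfolded banach_mazur_computable_on_def, rule_format, of "\<lambda>n. \<gamma> (t n)"] by blast
  qed
  have "normX 0 = 0" using N by blast
  then have "sup_dist normX Y G G \<le> ereal 0"
    unfolding sup_dist_def by (intro SUP_least) simp
  then have "\<not> banach_mazur_computable_on Y G"
    using approx[of G 0] iii(2) by auto
  then show ?thesis
    using approx borel_turing_imp_banach_mazur by blast
qed

end
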